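(* Let $k,L\ge 1$ be integers, $N=2^{L+1}k$, and let $\mathbf{A}\in\mathbb{R}^{N\times N}$ be given explicitly. The greedy HSS approximation procedure for explicit matrices (described in the context) uses $O(N^2k)$ arithmetic operations and returns $\mathbf{B}\in\mathrm{HSS}(L,k)$ with $$\|\mathbf{A}-\mathbf{B}\|_F^2\le 2L\cdot\min_{\mathbf{C}\in\mathrm{HSS}(L,k)}\|\mathbf{A}-\mathbf{C}\|_F^2 .$$
   Context: $\|\cdot\|_F$ is the Frobenius norm; $\mathrm{blockdiag}(\cdot)$ is the block-diagonal matrix with the listed (possibly rectangular) blocks. Blocks. A matrix $\mathbf{M}\in\mathbb{R}^{2^{\ell+1}k\times 2^{\ell+1}k}$ is partitioned into a $2^\ell\times 2^\ell$ array of blocks $\mathbf{M}_{i,j}\in\mathbb{R}^{2k\times 2k}$. Its $i$th HSS block-row is $r_i(\mathbf{M})=[\mathbf{M}_{i,1}\ \cdots\ \mathbf{M}_{i,i-1}\ \mathbf{M}_{i,i+1}\ \cdots\ \mathbf{M}_{i,2^\ell}]$ and its $i$th HSS block-column $c_i(\mathbf{M})$ is obtained by stacking vertically $\mathbf{M}_{1,i},\ldots,\mathbf{M}_{i-1,i},\mathbf{M}_{i+1,i},\ldots,\mathbf{M}_{2^\ell,i}$. HSS matrices. For $L\ge 0$, $\mathrm{HSS}(L,k)$ is the set of $\mathbf{B}\in\mathbb{R}^{2^{L+1}k\times 2^{L+1}k}$ for which there exist $\mathbf{D}^{(0)}\in\mathbb{R}^{2k\times 2k}$ and, for $\ell=1,\ldots,L$,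 matrices $\mathbf{U}^{(\ell)}=\mathrm{blockdiag}(\mathbf{U}^{(\ell)}_1,\ldots,\mathbf{U}^{(\ell)}_{2^\ell})$, $\mathbf{V}^{(\ell)}=\mathrm{blockdiag}(\mathbf{V}^{(\ell)}_1,\ldots,\mathbf{V}^{(\ell)}_{2^\ell})$, $\mathbf{D}^{(\ell)}=\mathrm{blockdiag}(\mathbf{D}^{(\ell)}_1,\ldots,\mathbf{D}^{(\ell)}_{2^\ell})$, with $\mathbf{U}^{(\ell)}_i,\mathbf{V}^{(\ell)}_i\in\mathbb{R}^{2k\times k}$ having orthonormal columns and $\mathbf{D}_i^{(\ell)}\in\mathbb{R}^{2k\times 2k}$, such that $\mathbf{B}^{(1)}=\mathbf{D}^{(0)}$, $\mathbf{B}^{(\ell+1)}=\mathbf{U}^{(\ell)}\mathbf{B}^{(\ell)}(\mathbf{V}^{(\ell)})^{\mathsf T}+\mathbf{D}^{(\ell)}$ for $\ell=1,\ldots,L$, and $\mathbf{B}=\mathbf{B}^{(L+1)}$ (telescoping factorization). Greedy procedure for explicit matrices. Set $\mathbf{A}^{(L+1)}=\mathbf{A}$. For $\ell=L,L-1,\ldots,1$: for each $i=1,\ldots,2^\ell$ let the columns of $\mathbf{U}_i^{(\ell)}\in\mathbb{R}^{2k\times k}$ be (orthonormal) top $k$ left singular vectors of $r_i(\mathbf{A}^{(\ell+1)})$, let the columns of $\mathbf{V}_i^{(\ell)}\in\mathbb{R}^{2k\times k}$ be top $k$ right singular vectors of $c_i(\mathbf{A}^{(\ell+1)})$, and let $\mathbf{D}_i^{(\ell)}=\mathbf{A}^{(\ell+1)}_{i,i}$;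 let $\mathbf{U}^{(\ell)},\mathbf{V}^{(\ell)},\mathbf{D}^{(\ell)}$ be the corresponding block-diagonal matrices and form explicitly $\mathbf{A}^{(\ell)}=(\mathbf{U}^{(\ell)})^{\mathsf T}(\mathbf{A}^{(\ell+1)}-\mathbf{D}^{(\ell)})\mathbf{V}^{(\ell)}\in\mathbb{R}^{2^\ell k\times 2^\ell k}$. Finally set $\mathbf{D}^{(0)}=\mathbf{A}^{(1)}$. The output $\mathbf{B}$ is the matrix with telescoping factorization given by $\mathbf{D}^{(0)}$ and $\mathbf{U}^{(\ell)},\mathbf{V}^{(\ell)},\mathbf{D}^{(\ell)}$. Cost convention: computing the SVD of a $2k\times n$ or $n\times 2k$ matrix with $n\ge 2k$ counts as $O(k^2n)$ arithmetic operations; matrix products are computed exploiting block-diagonal structure. *)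

theory Defs
  imports "Jordan_Normal_Form.Matrix" "HOL-Library.Monad_Syntax"
begin

text \<open>Blocks are numbered from 0, so the blocks of level \<open>l\<close> are those with index \<open>i < 2 ^ l\<close>.
  Matrices indexed by a level keep the numbering of the levels from 1.\<close>

definition frob_norm :: "real mat \<Rightarrow> real" where
  "frob_norm M = sqrt (\<Sum>i<dim_row M. \<Sum>j<dim_col M. (M $$ (i, j))\<^sup>2)"

definition orthonormal_cols :: "real mat \<Rightarrow> bool" where
  "orthonormal_cols M \<longleftrightarrow> transpose_mat M * M = 1\<^sub>m (dim_col M)"

text \<open>Thin singular value decomposition \<open>M = P S Q\<^sup>T\<close> with decreasingly ordered singular values.\<close>

definition is_svd :: "real mat \<Rightarrow> real mat \<Rightarrow> real mat \<Rightarrow> real mat \<Rightarrow> bool" where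
  "is_svd M P S Q \<longleftrightarrow>
     (let m = dim_row M; n = dim_col M; r = min m n in
      P \<in> carrier_mat m r \<and> orthonormal_cols P \<and>
      Q \<in> carrier_mat n r \<and> orthonormal_cols Q \<and>
      S \<in> carrier_mat r r \<and> diagonal_mat S \<and>
      (\<forall>i<r. 0 \<le> S $$ (i, i)) \<and>
      (\<forall>i<r. \<forall>j<r. i \<le> j \<longrightarrow> S $$ (j, j) \<le> S $$ (i, i)) \<and>
      M = P * S * transpose_mat Q)"

definition first_cols :: "nat \<Rightarrow> real mat \<Rightarrow> real mat" where
  "first_cols k M = mat (dim_row M) k (\<lambda>(a, b). M $$ (a, b))"

definition diag_block :: "nat \<Rightarrow> real mat \<Rightarrow> nat \<Rightarrow> real mat" where
  "diag_block k M i = mat (2 * k) (2 * k) (\<lambda>(a, b). M $$ (i * (2 * k) + a, i * (2 * k) + b))"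

definition hss_block_row :: "nat \<Rightarrow> nat \<Rightarrow> real mat \<Rightarrow> nat \<Rightarrow> real mat" where
  "hss_block_row k l M i =
     mat (2 * k) ((2 ^ l - 1) * (2 * k))
       (\<lambda>(a, b). M $$ (i * (2 * k) + a, if b < i * (2 * k) then b else b + 2 * k))"

definition hss_block_col :: "nat \<Rightarrow> nat \<Rightarrow> real mat \<Rightarrow> nat \<Rightarrow> real mat" where
  "hss_block_col k l M i =
     mat ((2 ^ l - 1) * (2 * k)) (2 * k)
       (\<lambda>(a, b). M $$ (if a < i * (2 * k) then a else a + 2 * k, i * (2 * k) + b))"

text \<open>\<open>telescope D0 U V D l\<close> is \<open>B\<close> with superscript \<open>l + 1\<close>; the lists \<open>U l\<close>, \<open>V l\<close>, \<open>D l\<close>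
  hold the diagonal blocks of level \<open>l\<close>.\<close>

primrec telescope ::
  "real mat \<Rightarrow> (nat \<Rightarrow> real mat list) \<Rightarrow> (nat \<Rightarrow> real mat list) \<Rightarrow> (nat \<Rightarrow> real mat list) \<Rightarrow> nat \<Rightarrow> real mat"
where
  "telescope D0 U V D 0 = D0"
| "telescope D0 U V D (Suc l) =
     diag_block_mat (U (Suc l)) * telescope D0 U V D l * transpose_mat (diag_block_mat (V (Suc l)))
     + diag_block_mat (D (Suc l))"

definition HSS :: "nat \<Rightarrow> nat \<Rightarrow> real mat set" where
  "HSS L k = {B. \<exists>D0 U V D.
     D0 \<in> carrier_mat (2 * k) (2 * k) \<and>
     (\<forall>l\<in>{1..L}.
        length (U l) = 2 ^ l \<and> length (V l) = 2 ^ l \<and> length (D l) = 2 ^ l \<and>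
        (\<forall>W\<in>set (U l) \<union> set (V l). W \<in> carrier_mat (2 * k) k \<and> orthonormal_cols W) \<and>
        (\<forall>W\<in>set (D l). W \<in> carrier_mat (2 * k) (2 * k))) \<and>
     B = telescope D0 U V D L}"

text \<open>Computations with an operation count. They are nondeterministic, since singular vectors are
  not unique: a computation is the set of its possible runs, each with its result and the number
  of arithmetic operations it uses.\<close>

datatype 'a comp = Comp (runs: "('a \<times> nat) set")

definition return :: "'a \<Rightarrow> 'a comp" where
  "return x = Comp {(x, 0)}"

definition bind_comp :: "'a comp \<Rightarrow> ('a \<Rightarrow> 'b comp) \<Rightarrow> 'b comp" where
  "bind_comp m f = Comp {(y, s + t) | x s y t. (x, s) \<in> runs m \<and> (y, t) \<in> runs (f x)}"

adhoc_overloading Monad_Syntax.bind \<rightleftharpoons> bind_comp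

primrec map_comp :: "('a \<Rightarrow> 'b comp) \<Rightarrow> 'a list \<Rightarrow> 'b list comp" where
  "map_comp f [] = return []"
| "map_comp f (x # xs) = do { y \<leftarrow> f x; ys \<leftarrow> map_comp f xs; return (y # ys) }"

text \<open>\<open>svd_cost m n\<close> is the cost charged for the singular value decomposition of an
  \<open>m \<times> n\<close> matrix.\<close>

definition svd_comp ::
  "(nat \<Rightarrow> nat \<Rightarrow> nat) \<Rightarrow> real mat \<Rightarrow> (real mat \<times> real mat \<times> real mat) comp" where
  "svd_comp svd_cost M =
     Comp {((P, S, Q), svd_cost (dim_row M) (dim_col M)) | P S Q. is_svd M P S Q}"

text \<open>Each of the \<open>m p\<close> entries of the product of an \<open>m \<times> n\<close> and an \<open>n \<times> p\<close> matrix takes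
  \<open>n\<close> multiplications and \<open>n - 1\<close> additions.\<close>

definition mult_cost :: "nat \<Rightarrow> nat \<Rightarrow> nat \<Rightarrow> nat" where
  "mult_cost m n p = m * p * (n + (n - 1))"

text \<open>Products with a block-diagonal factor multiply each diagonal block with the corresponding
  slab of the other factor; sums with a block-diagonal matrix touch its diagonal blocks only.\<close>

definition mult_diag_left :: "real mat list \<Rightarrow> real mat \<Rightarrow> real mat comp" where
  "mult_diag_left Ws X = Comp {(diag_block_mat Ws * X,
     \<Sum>W\<leftarrow>Ws. mult_cost (dim_row W) (dim_col W) (dim_col X))}"

definition mult_diag_right :: "real mat \<Rightarrow> real mat list \<Rightarrow> real mat comp" where
  "mult_diag_right X Ws = Comp {(X * diag_block_mat Ws,
     \<Sum>W\<leftarrow>Ws. mult_cost (dim_row X) (dim_row W) (dim_col W))}"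

definition add_diag :: "real mat \<Rightarrow> real mat list \<Rightarrow> real mat comp" where
  "add_diag X Ws = Comp {(X + diag_block_mat Ws, \<Sum>W\<leftarrow>Ws. dim_row W * dim_col W)}"

definition minus_diag :: "real mat \<Rightarrow> real mat list \<Rightarrow> real mat comp" where
  "minus_diag X Ws = Comp {(X - diag_block_mat Ws, \<Sum>W\<leftarrow>Ws. dim_row W * dim_col W)}"

text \<open>\<open>greedy_factors svd_cost k l A\<close> treats the levels \<open>l, l - 1, \<dots>, 1\<close>, starting from the matrix
  \<open>A\<close> with superscript \<open>l + 1\<close>, and returns \<open>(D0, U, V, D)\<close>. Transposing, extracting a block and
  selecting columns take no arithmetic operations.\<close>

primrec greedy_factors ::
  "(nat \<Rightarrow> nat \<Rightarrow> nat) \<Rightarrow> nat \<Rightarrow> nat \<Rightarrow> real mat \<Rightarrow>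
   (real mat \<times> (nat \<Rightarrow> real mat list) \<times> (nat \<Rightarrow> real mat list) \<times> (nat \<Rightarrow> real mat list)) comp"
where
  "greedy_factors svd_cost k 0 A = return (A, \<lambda>_. [], \<lambda>_. [], \<lambda>_. [])"
| "greedy_factors svd_cost k (Suc l) A = do {
     Us \<leftarrow> map_comp (\<lambda>i. do {
              (P, S, Q) \<leftarrow> svd_comp svd_cost (hss_block_row k (Suc l) A i);
              return (first_cols k P) }) [0..<2 ^ Suc l];
     Vs \<leftarrow> map_comp (\<lambda>i. do {
              (P, S, Q) \<leftarrow> svd_comp svd_cost (hss_block_col k (Suc l) A i);
              return (first_cols k Q) }) [0..<2 ^ Suc l];
     let Ds = map (diag_block k A) [0..<2 ^ Suc l];
     X \<leftarrow> minus_diag A Ds;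
     Y \<leftarrow> mult_diag_left (map transpose_mat Us) X;
     A' \<leftarrow> mult_diag_right Y Vs;
     (D0, U, V, D) \<leftarrow> greedy_factors svd_cost k l A';
     return (D0, U(Suc l := Us), V(Suc l := Vs), D(Suc l := Ds)) }"

primrec telescope_comp ::
  "real mat \<Rightarrow> (nat \<Rightarrow> real mat list) \<Rightarrow> (nat \<Rightarrow> real mat list) \<Rightarrow> (nat \<Rightarrow> real mat list) \<Rightarrow> nat \<Rightarrow> real mat comp"
where
  "telescope_comp D0 U V D 0 = return D0"
| "telescope_comp D0 U V D (Suc l) = do {
     B \<leftarrow> telescope_comp D0 U V D l;
     X \<leftarrow> mult_diag_left (U (Suc l)) B;
     Y \<leftarrow> mult_diag_right X (map transpose_mat (V (Suc l)));
     add_diag Y (D (Suc l)) }"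

text \<open>The count includes multiplying out the telescoping factorization, so it also bounds the cost
  of computing the output in factored form only.\<close>

definition greedy_hss :: "(nat \<Rightarrow> nat \<Rightarrow> nat) \<Rightarrow> nat \<Rightarrow> nat \<Rightarrow> real mat \<Rightarrow> real mat comp" where
  "greedy_hss svd_cost k L A = do {
     (D0, U, V, D) \<leftarrow> greedy_factors svd_cost k L A;
     telescope_comp D0 U V D L }"

end

theory Submission
  imports Defs "Jordan_Normal_Form.Determinant"
begin

text \<open>Let \<open>E\<close> be the part of \<open>A\<close> off the diagonal blocks at the finest level. With \<open>U\<close>, \<open>V\<close> the
  factors of that level and \<open>B'\<close> the result for \<open>A' = U\<^sup>T E V\<close>, the squared error is
  \<open>|E - U U\<^sup>T E V V\<^sup>T|\<^sup>2 + |A' - B'|\<^sup>2\<close>. The first term is at most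
  \<open>|E - U U\<^sup>T E|\<^sup>2 + |E - E V V\<^sup>T|\<^sup>2\<close>; as the HSS block rows and columns of any HSS matrix \<open>C\<close> have
  rank at most \<open>k\<close>, optimality of truncated singular value decompositions bounds it by
  \<open>2 |A - C|\<^sup>2\<close>. For the second term, compressing \<open>C\<close> by the same \<open>U\<close>, \<open>V\<close> gives an HSS matrix with one
  level less that is no farther from \<open>A'\<close> than \<open>C\<close> is from \<open>A\<close>, so each level adds at most
  \<open>2 |A - C|\<^sup>2\<close>. The minimum is attained because the set of HSS matrices is closed, which follows from
  compactness of the sets of orthonormal factors.\<close>

section \<open>Frobenius inner product\<close>

text \<open>Truncated decompositions enter through Ky Fan's maximum principle: among matrices with k
  orthonormal columns the leading left singular vectors capture most of M, measured by
  \<open>fsq (W\<^sup>T * M)\<close>. As \<open>fsq E - fsq (W\<^sup>T * E)\<close> is the squared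
  distance of E from the matrices \<open>W * B\<close>, rank bounds become statements about
  orthonormal block-diagonal W, and one such W treats all block rows at once. The obstacle is that
  the factors of an HSS matrix are not unique: the k by k diagonal blocks of the coarse matrix can
  be traded against D. Normalizing them to zero makes the coarse matrix a polynomial expression in
  the entries of C, U and V, which serves both compression and passage to limits. Existence of
  singular value decompositions is proved because a run chooses one at every block, and claims about
  all runs would be vacuous without any; it also provides QR factorizations. The factor 2 L is 2 per
  level: a constant \<gamma> for the coarser level becomes 2 + \<gamma>, starting from 0 because at
  L = 0 the input is returned.\<close>

lemma mat_assoc:
  fixes A B C :: "'a::semiring_0 mat"
  assumes "dim_col A = dim_row B" "dim_col B = dim_row C"
  shows "A * B * C = A * (B * C)"
  using assms by (intro assoc_mult_mat[of _ "dim_row A" "dim_col A" _ "dim_col B" _ "dim_col C"]) auto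

text \<open>This rule and its neighbours on associativity and differences take equations between
  dimensions as side conditions instead of carrier memberships. No size variable then remains to be
  guessed, so the simplifier can rewrite with them.\<close>

lemma mat_transpose_mult:
  fixes A B :: "'a::comm_semiring_0 mat"
  assumes "dim_col A = dim_row B"
  shows "(A * B)\<^sup>T = B\<^sup>T * A\<^sup>T"
  using assms by (intro transpose_mult[of _ "dim_row A" "dim_col A" _ "dim_col B"]) auto

lemma index_mult_sum:
  fixes A B :: "'a::semiring_0 mat"
  assumes "i < dim_row A" "j < dim_col B" "dim_col A = dim_row B"
  shows "(A * B) $$ (i, j) = (\<Sum>c<dim_row B. A $$ (i, c) * B $$ (c, j))"
  using assms by (auto simp: scalar_prod_def atLeast0LessThan intro!: sum.cong)

lemma mat_mult_minus:
  fixes A B C :: "'a::ring mat"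
  assumes "dim_col A = dim_row B" "dim_row B = dim_row C" "dim_col B = dim_col C"
  shows "A * (B - C) = A * B - A * C"
  using assms by (intro mult_minus_distrib_mat[of _ "dim_row A" "dim_row B" _ "dim_col B"] carrier_matI) simp_all

lemma mat_minus_mult:
  fixes A B C :: "'a::ring mat"
  assumes "dim_col A = dim_row C" "dim_row A = dim_row B" "dim_col A = dim_col B"
  shows "(A - B) * C = A * C - B * C"
  using assms by (intro minus_mult_distrib_mat[of _ "dim_row A" "dim_col A" _ _ "dim_col C"] carrier_matI) simp_all

definition ip :: "real mat \<Rightarrow> real mat \<Rightarrow> real" where
  "ip M N = (\<Sum>i<dim_row M. \<Sum>j<dim_col M. M $$ (i, j) * N $$ (i, j))"

abbreviation fsq :: "real mat \<Rightarrow> real" where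
  "fsq M \<equiv> ip M M"

lemma ip_sum:
  assumes "M \<in> carrier_mat m n"
  shows "ip M N = (\<Sum>i<m. \<Sum>j<n. M $$ (i, j) * N $$ (i, j))"
  using assms by (simp add: ip_def)

lemma fsq_nonneg: "0 \<le> fsq M"
  by (auto simp: ip_def intro!: sum_nonneg)

lemma frob_norm_sq: "(frob_norm M)\<^sup>2 = fsq M"
proof -
  have "0 \<le> (\<Sum>i<dim_row M. \<Sum>j<dim_col M. (M $$ (i, j))\<^sup>2)"
    by (intro sum_nonneg) auto
  then show ?thesis by (simp add: frob_norm_def ip_def power2_eq_square)
qed

lemma ip_commute: "dim_row M = dim_row N \<Longrightarrow> dim_col M = dim_col N \<Longrightarrow> ip M N = ip N M"
  by (simp add: ip_def mult.commute)

lemma ip_transpose: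
  assumes "dim_row M = dim_row N" "dim_col M = dim_col N"
  shows "ip M\<^sup>T N\<^sup>T = ip M N"
  unfolding ip_def using assms by (subst sum.swap) (auto intro!: sum.cong)

lemma ip_adjoint:
  assumes "dim_row U = dim_row Y" "dim_col U = dim_row X" "dim_col X = dim_col Y"
  shows "ip (U * X) Y = ip X (U\<^sup>T * Y)"
proof -
  have "ip (U * X) Y = (\<Sum>i<dim_row U. \<Sum>j<dim_col X. \<Sum>c<dim_row X. U $$ (i, c) * X $$ (c, j) * Y $$ (i, j))"
    unfolding ip_def using assms by (auto simp: index_mult_sum sum_distrib_right simp del: index_mult_mat(1) intro!: sum.cong)
  also have "\<dots> = (\<Sum>j<dim_col X. \<Sum>i<dim_row U. \<Sum>c<dim_row X. U $$ (i, c) * X $$ (c, j) * Y $$ (i, j))"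
    by (rule sum.swap)
  also have "\<dots> = (\<Sum>j<dim_col X. \<Sum>c<dim_row X. \<Sum>i<dim_row U. U $$ (i, c) * X $$ (c, j) * Y $$ (i, j))"
    by (intro sum.cong refl sum.swap)
  also have "\<dots> = (\<Sum>c<dim_row X. \<Sum>j<dim_col X. \<Sum>i<dim_row U. U $$ (i, c) * X $$ (c, j) * Y $$ (i, j))"
    by (rule sum.swap)
  also have "\<dots> = ip X (U\<^sup>T * Y)"
    unfolding ip_def using assms by (auto simp: index_mult_sum sum_distrib_left mult_ac simp del: index_mult_mat(1) intro!: sum.cong)
  finally show ?thesis .
qed

lemma ip_adjoint_right:
  assumes "dim_row X = dim_row Y" "dim_col V = dim_col X" "dim_row V = dim_col Y"
  shows "ip (X * V\<^sup>T) Y = ip X (Y * V)"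
proof -
  have "ip (X * V\<^sup>T) Y = ip (V * X\<^sup>T) Y\<^sup>T"
    using assms by (subst ip_transpose[symmetric]) (simp_all add: mat_transpose_mult)
  also have "\<dots> = ip X\<^sup>T (V\<^sup>T * Y\<^sup>T)"
    using assms by (intro ip_adjoint) auto
  also have "\<dots> = ip X (Y * V)"
    using assms by (subst ip_transpose[symmetric]) (simp_all add: mat_transpose_mult)
  finally show ?thesis .
qed

lemma fsq_minus:
  assumes "dim_row M = dim_row N" "dim_col M = dim_col N"
  shows "fsq (M - N) = fsq M - 2 * ip M N + fsq N"
proof -
  have "fsq (M - N) = (\<Sum>i<dim_row M. \<Sum>j<dim_col M. M $$ (i, j) * M $$ (i, j)
      - 2 * (M $$ (i, j) * N $$ (i, j)) + N $$ (i, j) * N $$ (i, j))"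
    unfolding ip_def using assms by (auto simp: algebra_simps intro!: sum.cong)
  also have "\<dots> = fsq M - 2 * ip M N + fsq N"
    using assms by (simp add: ip_def sum.distrib sum_subtractf sum_distrib_left)
  finally show ?thesis .
qed

lemma fsq_mult_orthonormal:
  assumes "orthonormal_cols U" "dim_col U = dim_row X"
  shows "fsq (U * X) = fsq X"
proof -
  have "fsq (U * X) = ip X (U\<^sup>T * (U * X))" using assms by (intro ip_adjoint) auto
  also have "U\<^sup>T * (U * X) = U\<^sup>T * U * X" using assms by (simp add: mat_assoc)
  also have "\<dots> = X" using assms by (simp add: orthonormal_cols_def)
  finally show ?thesis .
qed

lemma fsq_mult_orthonormal_right:
  assumes "orthonormal_cols V" "dim_col V = dim_col X"
  shows "fsq (X * V\<^sup>T) = fsq X"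
  using fsq_mult_orthonormal[of V "X\<^sup>T"] assms ip_transpose[of "X * V\<^sup>T" "X * V\<^sup>T"] ip_transpose[of X X]
  by (simp add: mat_transpose_mult)

text \<open>Expand the square: by adjointness the cross term is the inner product of
  \<open>B\<close> with \<open>U\<^sup>T * E * V\<close>, and the orthonormal factors preserve
  \<open>fsq B\<close>; completing the square in \<open>B\<close> gives the claim. It separates what
  compression loses from how well \<open>B\<close> approximates the compressed matrix.\<close>

lemma fsq_split:
  assumes "orthonormal_cols U" "orthonormal_cols V"
    and "dim_row U = dim_row E" "dim_row V = dim_col E" "dim_col U = dim_row B" "dim_col V = dim_col B"
  shows "fsq (E - U * B * V\<^sup>T) = fsq E - fsq (U\<^sup>T * E * V) + fsq (U\<^sup>T * E * V - B)"
proof -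
  have "ip (U * B * V\<^sup>T) E = ip B (U\<^sup>T * (E * V))"
  proof -
    have "ip (U * B * V\<^sup>T) E = ip (U * B) (E * V)"
      using assms by (intro ip_adjoint_right) auto
    also have "\<dots> = ip B (U\<^sup>T * (E * V))"
      using assms by (intro ip_adjoint) auto
    finally show ?thesis .
  qed
  moreover have "ip (U * B * V\<^sup>T) E = ip E (U * B * V\<^sup>T)"
    using assms by (intro ip_commute) auto
  moreover have "ip B (U\<^sup>T * (E * V)) = ip (U\<^sup>T * (E * V)) B"
    using assms by (intro ip_commute) auto
  moreover have "fsq (U * B * V\<^sup>T) = fsq B"
    using assms by (simp add: fsq_mult_orthonormal_right fsq_mult_orthonormal)
  ultimately show ?thesis
    using assms by (simp add: fsq_minus mat_assoc)
qed

lemma orthonormal_cols_one: "orthonormal_cols (1\<^sub>m n)"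
  by (simp add: orthonormal_cols_def)

text \<open>For fixed \<open>U\<close> the best \<open>B\<close> is \<open>U\<^sup>T * E\<close>, so
  the first two terms give the squared distance of \<open>E\<close> from the matrices with columns
  in the range of \<open>U\<close>.\<close>

lemma fsq_split_left:
  assumes "orthonormal_cols U" "dim_row U = dim_row E" "dim_col U = dim_row B" "dim_col E = dim_col B"
  shows "fsq (E - U * B) = fsq E - fsq (U\<^sup>T * E) + fsq (U\<^sup>T * E - B)"
  using fsq_split[of U "1\<^sub>m (dim_col E)" E B] assms by (simp add: orthonormal_cols_one)

text \<open>In the splitting take \<open>B = U\<^sup>T * E\<close>: the last term vanishes and the
  left side is nonnegative.\<close>

lemma fsq_transpose_mult_le:
  assumes "orthonormal_cols U" "dim_row U = dim_row E"
  shows "fsq (U\<^sup>T * E) \<le> fsq E"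
  using fsq_split_left[of U E "U\<^sup>T * E"] fsq_nonneg[of "E - U * (U\<^sup>T * E)"] assms
  by (simp add: fsq_minus)

lemma fsq_transpose: "fsq M\<^sup>T = fsq M"
  by (simp add: ip_transpose)

lemma fsq_mult_le:
  assumes "orthonormal_cols V" "dim_row V = dim_col E"
  shows "fsq (E * V) \<le> fsq E"
  using fsq_transpose_mult_le[of V "E\<^sup>T"] assms fsq_transpose[of "E * V"]
  by (simp add: fsq_transpose mat_transpose_mult)

text \<open>The two-sided residual is the orthogonal sum of \<open>E - U * U\<^sup>T * E\<close> and
  \<open>U * U\<^sup>T * (E - E * V * V\<^sup>T)\<close>. The second summand is the right residual
  projected to the range of \<open>U\<close>, hence no larger than the right residual
  itself.\<close>

lemma fsq_two_sided:
  assumes "orthonormal_cols U" "orthonormal_cols V" "dim_row U = dim_row E" "dim_row V = dim_col E"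
  shows "fsq E - fsq (U\<^sup>T * E * V) \<le> (fsq E - fsq (U\<^sup>T * E)) + (fsq E - fsq (E * V))"
proof -
  have residual: "fsq (X - X * V * V\<^sup>T) = fsq X - fsq (X * V)" if "dim_col X = dim_col E" for X
  proof -
    have "ip X (X * V * V\<^sup>T) = ip (X * V * V\<^sup>T) X"
      using that assms by (intro ip_commute) auto
    also have "\<dots> = fsq (X * V)"
      using that assms by (intro ip_adjoint_right) auto
    finally show ?thesis
      using that assms by (simp add: fsq_minus fsq_mult_orthonormal_right)
  qed
  have "fsq (U\<^sup>T * E) - fsq (U\<^sup>T * E * V) = fsq (U\<^sup>T * E - U\<^sup>T * E * V * V\<^sup>T)"
    using residual[of "U\<^sup>T * E"] by simp
  also have "U\<^sup>T * E - U\<^sup>T * E * V * V\<^sup>T = U\<^sup>T * (E - E * V * V\<^sup>T)"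
    using assms by (subst mat_mult_minus) (simp_all add: mat_assoc)
  also have "fsq \<dots> \<le> fsq (E - E * V * V\<^sup>T)"
    using assms by (intro fsq_transpose_mult_le) auto
  also have "\<dots> = fsq E - fsq (E * V)" by (simp add: residual)
  finally show ?thesis by simp
qed

lemma fsq_orthonormal_cols:
  assumes "orthonormal_cols W"
  shows "fsq W = dim_col W"
proof -
  have "fsq W = fsq (1\<^sub>m (dim_col W))"
    using fsq_mult_orthonormal[OF assms, of "1\<^sub>m (dim_col W)"] by simp
  also have "\<dots> = (\<Sum>i<dim_col W. \<Sum>j<dim_col W. if i = j then 1 else 0)"
    unfolding ip_def by (intro sum.cong) auto
  finally show ?thesis by simp
qed

section \<open>Convergence of matrices\<close>

text \<open>Bolzano-Weierstrass one coordinate at a time: a monotone subsequence for the new index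
  is bounded, hence convergent, and the coordinates treated before still converge along it.\<close>

lemma bounded_family_subseq:
  fixes f :: "nat \<Rightarrow> 'i \<Rightarrow> real"
  assumes "finite I" "\<And>n i. i \<in> I \<Longrightarrow> \<bar>f n i\<bar> \<le> B"
  shows "\<exists>r. strict_mono (r :: nat \<Rightarrow> nat) \<and> (\<forall>i\<in>I. convergent (\<lambda>n. f (r n) i))"
  using assms
proof (induction I rule: finite_induct)
  case empty
  show ?case by (intro exI[of _ id]) (simp add: strict_mono_def)
next
  case (insert j I)
  then obtain r where r: "strict_mono (r :: nat \<Rightarrow> nat)" "\<forall>i\<in>I. convergent (\<lambda>n. f (r n) i)"
    by auto
  obtain q where q: "strict_mono (q :: nat \<Rightarrow> nat)" "monoseq (\<lambda>n. f (r (q n)) j)"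
    using seq_monosub[of "\<lambda>n. f (r n) j"] by auto
  have "Bseq (\<lambda>n. f (r (q n)) j)"
    using insert.prems by (intro BseqI') auto
  then have "convergent (\<lambda>n. f (r (q n)) j)"
    using q(2) by (rule Bseq_monoseq_convergent)
  moreover have "convergent (\<lambda>n. f (r (q n)) i)" if "i \<in> I" for i
    using convergent_subseq_convergent[OF r(2)[rule_format, OF that] q(1)] by (simp add: comp_def)
  ultimately show ?case
    using strict_mono_o[OF r(1) q(1)] by (intro exI[of _ "r \<circ> q"]) (auto simp: comp_def)
qed

text \<open>Entrywise convergence at fixed dimensions, which is convergence in the Frobenius norm.
  The carriers are part of the predicate, so limits of products and transposes need no further size
  conditions.\<close>

definition mat_lim :: "nat \<Rightarrow> nat \<Rightarrow> (nat \<Rightarrow> real mat) \<Rightarrow> real mat \<Rightarrow> bool" where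
  "mat_lim m n X A \<longleftrightarrow> (\<forall>j. X j \<in> carrier_mat m n) \<and> A \<in> carrier_mat m n \<and>
     (\<forall>a<m. \<forall>b<n. (\<lambda>j. X j $$ (a, b)) \<longlonglongrightarrow> A $$ (a, b))"

lemma entry_sq_le_fsq:
  assumes "a < dim_row M" "b < dim_col M"
  shows "(M $$ (a, b))\<^sup>2 \<le> fsq M"
proof -
  have "(M $$ (a, b))\<^sup>2 \<le> (\<Sum>j<dim_col M. M $$ (a, j) * M $$ (a, j))"
    using member_le_sum[of b "{..<dim_col M}" "\<lambda>j. M $$ (a, j) * M $$ (a, j)"] assms
    by (simp add: power2_eq_square)
  also have "\<dots> \<le> fsq M"
    unfolding ip_def using assms
    by (intro member_le_sum[of a _ "\<lambda>i. \<Sum>j<dim_col M. M $$ (i, j) * M $$ (i, j)"] sum_nonneg) auto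
  finally show ?thesis .
qed

lemma fsq_le_0_iff:
  assumes "M \<in> carrier_mat m n"
  shows "fsq M \<le> 0 \<longleftrightarrow> M = 0\<^sub>m m n"
proof
  assume le: "fsq M \<le> 0"
  show "M = 0\<^sub>m m n"
  proof (rule eq_matI)
    fix a b assume "a < dim_row (0\<^sub>m m n :: real mat)" "b < dim_col (0\<^sub>m m n :: real mat)"
    then have ab: "a < m" "b < n" by auto
    then have "(M $$ (a, b))\<^sup>2 \<le> fsq M" using assms by (intro entry_sq_le_fsq) auto
    with le have "(M $$ (a, b))\<^sup>2 \<le> 0" by linarith
    then show "M $$ (a, b) = 0\<^sub>m m n $$ (a, b)" using ab by simp
  qed (use assms in auto)
qed (simp add: ip_def)

lemma mat_bounded_subseq:
  assumes "\<And>j. X j \<in> carrier_mat m n" "\<And>j. fsq (X j) \<le> B"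
  shows "\<exists>r A. strict_mono (r :: nat \<Rightarrow> nat) \<and> mat_lim m n (\<lambda>j. X (r j)) A"
proof -
  have "\<bar>X j $$ (a, b)\<bar> \<le> 1 + B" if "a < m" "b < n" for j a b
  proof -
    have "(X j $$ (a, b))\<^sup>2 \<le> B"
      using entry_sq_le_fsq[of a "X j" b] assms[of j] that by auto
    \<comment> \<open>Expanding the square bounds twice the absolute value of the entry by 1 plus
      its square, hence by 1 + B.\<close>
    moreover have "0 \<le> (1 - \<bar>X j $$ (a, b)\<bar>)\<^sup>2" "0 \<le> (X j $$ (a, b))\<^sup>2" by auto
    ultimately show ?thesis by (auto simp: power2_diff)
  qed
  then obtain r where r: "strict_mono (r :: nat \<Rightarrow> nat)"
      "\<forall>i\<in>{..<m} \<times> {..<n}. convergent (\<lambda>j. X (r j) $$ i)"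
    using bounded_family_subseq[of "{..<m} \<times> {..<n}" "\<lambda>j i. X j $$ i" "1 + B"] by auto
  have "mat_lim m n (\<lambda>j. X (r j)) (mat m n (\<lambda>i. lim (\<lambda>j. X (r j) $$ i)))"
    using r(2) assms(1) by (auto simp: mat_lim_def convergent_LIMSEQ_iff)
  with r(1) show ?thesis by blast
qed

lemma mat_lim_subseq:
  assumes "mat_lim m n X A" "strict_mono r"
  shows "mat_lim m n (\<lambda>j. X (r j)) A"
  using assms LIMSEQ_subseq_LIMSEQ[OF _ assms(2)]
  unfolding mat_lim_def comp_def by blast

lemma mat_lim_const: "A \<in> carrier_mat m n \<Longrightarrow> mat_lim m n (\<lambda>_. A) A"
  by (simp add: mat_lim_def)

lemma mat_lim_unique:
  assumes "mat_lim m n X A" "mat_lim m n X B"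
  shows "A = B"
proof (rule eq_matI)
  fix a b assume "a < dim_row B" "b < dim_col B"
  then have "a < m" "b < n" using assms(2) by (auto simp: mat_lim_def)
  then have "(\<lambda>j. X j $$ (a, b)) \<longlonglongrightarrow> A $$ (a, b)" "(\<lambda>j. X j $$ (a, b)) \<longlonglongrightarrow> B $$ (a, b)"
    using assms by (auto simp: mat_lim_def)
  then show "A $$ (a, b) = B $$ (a, b)" by (rule LIMSEQ_unique)
qed (use assms in \<open>auto simp: mat_lim_def\<close>)

lemma mat_lim_carrier:
  assumes "mat_lim m n X A"
  shows "X j \<in> carrier_mat m n" "A \<in> carrier_mat m n"
  using assms by (simp_all add: mat_lim_def)

lemma mat_lim_transpose:
  assumes "mat_lim m n X A"
  shows "mat_lim n m (\<lambda>j. (X j)\<^sup>T) A\<^sup>T"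
proof -
  have "(X j)\<^sup>T $$ (a, b) = X j $$ (b, a)" "A\<^sup>T $$ (a, b) = A $$ (b, a)" if "a < n" "b < m" for j a b
    using mat_lim_carrier(1)[OF assms, of j] mat_lim_carrier(2)[OF assms] that by auto
  then show ?thesis using assms by (simp add: mat_lim_def)
qed

lemma mat_lim_minus:
  assumes "mat_lim m n X A" "mat_lim m n Y B"
  shows "mat_lim m n (\<lambda>j. X j - Y j) (A - B)"
  unfolding mat_lim_def
proof (intro conjI allI impI)
  fix a b assume ab: "a < m" "b < n"
  have "(\<lambda>j. X j $$ (a, b) - Y j $$ (a, b)) \<longlonglongrightarrow> A $$ (a, b) - B $$ (a, b)"
    using assms ab by (intro tendsto_diff) (auto simp: mat_lim_def)
  moreover have "(X j - Y j) $$ (a, b) = X j $$ (a, b) - Y j $$ (a, b)" for j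
    using mat_lim_carrier(1)[OF assms(2), of j] ab by (intro index_minus_mat) auto
  moreover have "(A - B) $$ (a, b) = A $$ (a, b) - B $$ (a, b)"
    using mat_lim_carrier(2)[OF assms(2)] ab by (intro index_minus_mat) auto
  ultimately show "(\<lambda>j. (X j - Y j) $$ (a, b)) \<longlonglongrightarrow> (A - B) $$ (a, b)"
    by simp
qed (use mat_lim_carrier[OF assms(2)] in \<open>auto intro: minus_carrier_mat\<close>)

lemma mat_lim_mult:
  assumes "mat_lim m n X A" "mat_lim n p Y B"
  shows "mat_lim m p (\<lambda>j. X j * Y j) (A * B)"
  unfolding mat_lim_def
proof (intro conjI allI impI)
  fix a b assume ab: "a < m" "b < p"
  have "(\<lambda>j. \<Sum>c<n. X j $$ (a, c) * Y j $$ (c, b)) \<longlonglongrightarrow> (\<Sum>c<n. A $$ (a, c) * B $$ (c, b))"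
    using assms ab by (intro tendsto_sum tendsto_mult) (auto simp: mat_lim_def)
  moreover have "(X j * Y j) $$ (a, b) = (\<Sum>c<n. X j $$ (a, c) * Y j $$ (c, b))" for j
  proof -
    have "X j \<in> carrier_mat m n" "Y j \<in> carrier_mat n p" using assms by (simp_all add: mat_lim_def)
    then show ?thesis using ab index_mult_sum[of a "X j" b "Y j"] by simp
  qed
  moreover have "(A * B) $$ (a, b) = (\<Sum>c<n. A $$ (a, c) * B $$ (c, b))"
  proof -
    have "A \<in> carrier_mat m n" "B \<in> carrier_mat n p" using assms by (simp_all add: mat_lim_def)
    then show ?thesis using ab index_mult_sum[of a A b B] by simp
  qed
  ultimately show "(\<lambda>j. (X j * Y j) $$ (a, b)) \<longlonglongrightarrow> (A * B) $$ (a, b)"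
    by simp
qed (use mat_lim_carrier[OF assms(1)] mat_lim_carrier[OF assms(2)] in \<open>auto intro: mult_carrier_mat\<close>)

lemma mat_lim_ip:
  assumes "mat_lim m n X A" "mat_lim m n Y B"
  shows "(\<lambda>j. ip (X j) (Y j)) \<longlonglongrightarrow> ip A B"
proof -
  have "(\<lambda>j. \<Sum>a<m. \<Sum>b<n. X j $$ (a, b) * Y j $$ (a, b)) \<longlonglongrightarrow> (\<Sum>a<m. \<Sum>b<n. A $$ (a, b) * B $$ (a, b))"
    using assms by (intro tendsto_sum tendsto_mult) (auto simp: mat_lim_def)
  then show ?thesis
    using assms by (simp add: mat_lim_def ip_sum[of _ m n])
qed

text \<open>The extreme value theorem in sequential form. Only the values of \<open>f\<close> have
  to converge, so the points may be of any type, in particular pairs of matrices. If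
  \<open>f\<close> were unbounded, points with \<open>f (X n) > n\<close> would have no subsequence
  with convergent values; otherwise the hypothesis is applied to a maximizing sequence.\<close>

lemma attains_max_of_subseq:
  fixes f :: "'a \<Rightarrow> real"
  assumes "S \<noteq> {}"
    and sub: "\<And>X. (\<And>n. X n \<in> S) \<Longrightarrow>
      \<exists>r z. strict_mono (r :: nat \<Rightarrow> nat) \<and> z \<in> S \<and> (\<lambda>n. f (X (r n))) \<longlonglongrightarrow> f z"
  shows "\<exists>z\<in>S. \<forall>y\<in>S. f y \<le> f z"
proof -
  have bdd: "bdd_above (f ` S)"
  proof (rule ccontr)
    assume "\<not> bdd_above (f ` S)"
    then have "\<forall>n::nat. \<exists>x\<in>S. real n < f x"
      unfolding bdd_above_def by (auto simp: not_le)
    then obtain X where X: "\<And>n::nat. X n \<in> S" "\<And>n. real n < f (X n)"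
      by metis
    obtain r z where r: "strict_mono (r :: nat \<Rightarrow> nat)" "(\<lambda>n. f (X (r n))) \<longlonglongrightarrow> f z"
      using sub[of X] X(1) by blast
    have "filterlim (\<lambda>n. f (X (r n))) at_top sequentially"
    proof (rule filterlim_at_top_mono[OF filterlim_real_sequentially], rule eventuallyI)
      fix n
      have "real n \<le> real (r n)" using seq_suble[OF r(1)] by simp
      also have "\<dots> < f (X (r n))" by (rule X(2))
      finally show "real n \<le> f (X (r n))" by simp
    qed
    with r(2) show False
      using not_tendsto_and_filterlim_at_infinity[of sequentially "\<lambda>n. f (X (r n))" "f z"]
      by (auto intro: filterlim_at_top_imp_at_infinity)
  qed
  have "\<exists>x\<in>S. Sup (f ` S) - inverse (real (Suc n)) < f x" for n :: nat
    using less_cSup_iff[OF _ bdd, of "Sup (f ` S) - inverse (real (Suc n))"] assms(1) by auto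
  then obtain X where X: "\<And>n::nat. X n \<in> S" "\<And>n. Sup (f ` S) - inverse (real (Suc n)) < f (X n)"
    by metis
  obtain r z where r: "strict_mono (r :: nat \<Rightarrow> nat)" "z \<in> S" "(\<lambda>n. f (X (r n))) \<longlonglongrightarrow> f z"
    using sub[of X] X(1) by blast
  have "(\<lambda>n. Sup (f ` S) - inverse (real (Suc (r n)))) \<longlonglongrightarrow> Sup (f ` S) - 0"
    using LIMSEQ_subseq_LIMSEQ[OF LIMSEQ_inverse_real_of_nat r(1)]
    by (intro tendsto_intros) (simp add: comp_def)
  then have "Sup (f ` S) - 0 \<le> f z"
    using r(3) by (rule LIMSEQ_le) (use X(2) in \<open>auto intro: less_imp_le\<close>)
  then have "f y \<le> f z" if "y \<in> S" for y
    using cSup_upper[OF imageI[OF that] bdd] by simp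
  with r(2) show ?thesis by blast
qed

section \<open>Existence of singular value decompositions\<close>

lemma ip_smult_left: "ip (c \<cdot>\<^sub>m M) N = c * ip M N"
  by (simp add: ip_def sum_distrib_left mult.assoc)

lemma ip_smult_right:
  assumes "dim_row M = dim_row N" "dim_col M = dim_col N"
  shows "ip M (c \<cdot>\<^sub>m N) = c * ip M N"
  using assms by (simp add: ip_commute[of M] ip_smult_left)

text \<open>The rows of \<open>A\<close> are the given vectors, padded with zero rows to a square
  matrix. Row \<open>j < n\<close> is zero, so the determinant vanishes and the kernel contains a
  nonzero vector, which is then normalized.\<close>

lemma exists_unit_orthogonal:
  assumes "j < n" "\<And>i. i < j \<Longrightarrow> v i \<in> carrier_mat n 1"
  shows "\<exists>y\<in>carrier_mat n 1. fsq y = 1 \<and> (\<forall>i<j. ip (v i) y = 0)"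
proof -
  define A where "A = mat n n (\<lambda>(i, c). if i < j then v i $$ (c, 0) else 0)"
  have A: "A \<in> carrier_mat n n" by (simp add: A_def)
  have "det A = 0"
  proof -
    have "A = mat\<^sub>r n n (\<lambda>i. if i = j then 0\<^sub>v n else row A i)"
      by (rule eq_matI) (use assms(1) in \<open>auto simp: A_def\<close>)
    then show ?thesis
      using det_row_0[OF assms(1), of "row A"] A by auto
  qed
  then obtain w where w: "w \<in> carrier_vec n" "w \<noteq> 0\<^sub>v n" "A *\<^sub>v w = 0\<^sub>v n"
    using det_0_iff_vec_prod_zero_field[OF A] by auto
  define z where "z = mat n 1 (\<lambda>(c, _). w $ c)"
  have z: "z \<in> carrier_mat n 1" by (simp add: z_def)
  have orth: "ip (v i) z = 0" if "i < j" for i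
  proof -
    have "ip (v i) z = (A *\<^sub>v w) $ i"
      using that assms w(1) by (auto simp: ip_sum[of _ n 1] A_def z_def scalar_prod_def atLeast0LessThan intro!: sum.cong)
    also have "\<dots> = 0" using that assms(1) w(3) by simp
    finally show ?thesis .
  qed
  have "fsq z > 0"
  proof (rule ccontr)
    assume "\<not> fsq z > 0"
    then have "z = 0\<^sub>m n 1" using fsq_le_0_iff[OF z] by simp
    then have "z $$ (c, 0) = 0" if "c < n" for c using that by simp
    then have "w = 0\<^sub>v n" using w(1) by (intro eq_vecI) (auto simp: z_def)
    with w(2) show False by contradiction
  qed
  define y where "y = (1 / sqrt (fsq z)) \<cdot>\<^sub>m z"
  have "fsq y = 1"
    using \<open>fsq z > 0\<close> by (simp add: y_def ip_smult_left ip_smult_right)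
  moreover have "ip (v i) y = 0" if "i < j" for i
    using orth[OF that] carrier_matD[OF assms(2)[OF that]] carrier_matD[OF z]
    by (simp add: y_def ip_smult_right)
  moreover have "y \<in> carrier_mat n 1" using z by (simp add: y_def)
  ultimately show ?thesis by blast
qed

text \<open>With \<open>z = M\<^sup>T x\<close>, testing the maximality at \<open>z / |z|\<close> gives \<open>|z| \<le> \<sigma>\<close>,
  hence \<open>|z - \<sigma> y|\<^sup>2 = |z|\<^sup>2 - \<sigma>\<^sup>2 \<le> 0\<close>.\<close>

lemma maximizer_singular_pair:
  assumes M: "M \<in> carrier_mat m n" and x: "x \<in> carrier_mat m 1" and y: "y \<in> carrier_mat n 1"
    and "fsq y = 1" and \<sigma>: "0 \<le> \<sigma>" "\<sigma> = ip x (M * y)"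
    and v: "\<And>i. i < j \<Longrightarrow> v i \<in> carrier_mat n 1" "\<And>i. i < j \<Longrightarrow> ip (v i) (M\<^sup>T * x) = 0"
    and max: "\<And>y'. y' \<in> carrier_mat n 1 \<Longrightarrow> fsq y' = 1 \<Longrightarrow> (\<And>i. i < j \<Longrightarrow> ip (v i) y' = 0) \<Longrightarrow> ip x (M * y') \<le> \<sigma>"
  shows "M\<^sup>T * x = \<sigma> \<cdot>\<^sub>m y"
proof -
  define z where "z = M\<^sup>T * x"
  have z: "z \<in> carrier_mat n 1" using M x by (simp add: z_def)
  have ipz: "ip x (M * y') = ip z y'" if "y' \<in> carrier_mat n 1" for y'
    using ip_adjoint[of "M\<^sup>T" y' x] M x that by (simp add: z_def)
  have "fsq z \<le> \<sigma>\<^sup>2"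
  proof (cases "fsq z > 0")
    case True
    let ?y = "(1 / sqrt (fsq z)) \<cdot>\<^sub>m z"
    have "ip x (M * ?y) \<le> \<sigma>"
      using True z v(2) by (intro max)
        (simp_all add: ip_smult_left ip_smult_right v(1)[THEN carrier_matD(1)] v(1)[THEN carrier_matD(2)]
          carrier_matD[OF z] flip: z_def)
    moreover have "ip x (M * ?y) = sqrt (fsq z)"
      using True z by (simp add: ipz ip_smult_right real_div_sqrt)
    ultimately have "sqrt (fsq z) \<le> \<sigma>" by simp
    then show ?thesis using True by (simp add: real_le_lsqrt sqrt_le_D)
  next
    case False
    then show ?thesis by (simp add: order_trans[of _ 0])
  qed
  moreover have "fsq (z - \<sigma> \<cdot>\<^sub>m y) = fsq z - \<sigma>\<^sup>2"
    using z y \<sigma>(2) \<open>fsq y = 1\<close> ipz[OF y]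
    by (simp add: fsq_minus ip_smult_left ip_smult_right power2_eq_square)
  ultimately have "z - \<sigma> \<cdot>\<^sub>m y = 0\<^sub>m n 1"
    using fsq_le_0_iff[of "z - \<sigma> \<cdot>\<^sub>m y" n 1] y by (simp add: minus_carrier_mat)
  then have "(z - \<sigma> \<cdot>\<^sub>m y) $$ (a, b) = 0" if "a < n" "b < 1" for a b
    using that by simp
  then show ?thesis
    unfolding z_def[symmetric] using z y by (intro eq_matI) auto
qed

text \<open>Vectors are one-column matrices, so \<open>ip\<close> and matrix products apply to them.
  Only the first \<open>j\<close> values of \<open>v\<close> matter, which lets a sequence be
  constrained by itself: \<open>v j \<in> orth_unit n j v\<close> for all \<open>j < r\<close> says
  that the first \<open>r\<close> vectors are orthonormal.\<close>

definition orth_unit :: "nat \<Rightarrow> nat \<Rightarrow> (nat \<Rightarrow> real mat) \<Rightarrow> real mat set" where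
  "orth_unit n j v = {y \<in> carrier_mat n 1. fsq y = 1 \<and> (\<forall>i<j. ip (v i) y = 0)}"

text \<open>Unit vectors are bounded, and the defining equations pass to entrywise limits because
  \<open>ip\<close> is continuous.\<close>

lemma orth_unit_subseq:
  assumes "\<And>i. i < j \<Longrightarrow> v i \<in> carrier_mat n 1" "\<And>k. Y k \<in> orth_unit n j v"
  shows "\<exists>r y. strict_mono (r :: nat \<Rightarrow> nat) \<and> mat_lim n 1 (\<lambda>k. Y (r k)) y \<and> y \<in> orth_unit n j v"
proof -
  obtain r y where r: "strict_mono (r :: nat \<Rightarrow> nat)" "mat_lim n 1 (\<lambda>k. Y (r k)) y"
    using mat_bounded_subseq[of Y n 1 1] assms(2) by (auto simp: orth_unit_def)
  have "fsq y = 1"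
    using mat_lim_ip[OF r(2) r(2)] assms(2) by (simp add: orth_unit_def LIMSEQ_const_iff)
  moreover have "ip (v i) y = 0" if "i < j" for i
    using mat_lim_ip[OF mat_lim_const r(2), of "v i"] assms that by (simp add: orth_unit_def LIMSEQ_const_iff)
  moreover have "y \<in> carrier_mat n 1" using r(2) by (simp add: mat_lim_def)
  ultimately show ?thesis using r by (auto simp: orth_unit_def)
qed

text \<open>The pair maximizes \<open>ip x (M * y)\<close> over unit vectors orthogonal to the pairs
  already found; compactness in both variables gives a maximizer. That \<open>M\<^sup>T * x\<close>
  is orthogonal to the earlier \<open>v i\<close> follows from
  \<open>M * v i = s i \<cdot>\<^sub>m u i\<close>, and symmetrically for \<open>M * y\<close>. So
  \<open>maximizer_singular_pair\<close> applies to \<open>M\<close> with \<open>x\<close> fixed and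
  to \<open>M\<^sup>T\<close> with \<open>y\<close> fixed.\<close>

lemma exists_next_singular_pair:
  assumes M: "M \<in> carrier_mat m n" and j: "j < m" "j < n"
    and u: "\<And>i. i < j \<Longrightarrow> u i \<in> carrier_mat m 1" and v: "\<And>i. i < j \<Longrightarrow> v i \<in> carrier_mat n 1"
    and Mv: "\<And>i. i < j \<Longrightarrow> M * v i = s i \<cdot>\<^sub>m u i" and Mu: "\<And>i. i < j \<Longrightarrow> M\<^sup>T * u i = s i \<cdot>\<^sub>m v i"
  shows "\<exists>x\<in>orth_unit m j u. \<exists>y\<in>orth_unit n j v. \<exists>\<sigma>\<ge>0. M * y = \<sigma> \<cdot>\<^sub>m x \<and> M\<^sup>T * x = \<sigma> \<cdot>\<^sub>m y \<and>
    (\<forall>x'\<in>orth_unit m j u. \<forall>y'\<in>orth_unit n j v. ip x' (M * y') \<le> \<sigma>)"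
proof -
  let ?S = "orth_unit m j u \<times> orth_unit n j v"
  have "?S \<noteq> {}"
    using exists_unit_orthogonal[of j m u] exists_unit_orthogonal[of j n v] j u v
    by (auto simp: orth_unit_def)
  moreover have "\<exists>r z. strict_mono (r :: nat \<Rightarrow> nat) \<and> z \<in> ?S \<and>
      (\<lambda>k. case X (r k) of (x, y) \<Rightarrow> ip x (M * y)) \<longlonglongrightarrow> (case z of (x, y) \<Rightarrow> ip x (M * y))"
    if X: "\<And>k. X k \<in> ?S" for X
  proof -
    obtain r x where r: "strict_mono (r :: nat \<Rightarrow> nat)" "mat_lim m 1 (\<lambda>k. fst (X (r k))) x" "x \<in> orth_unit m j u"
      using orth_unit_subseq[of j u m "\<lambda>k. fst (X k)"] u X by (auto simp: mem_Times_iff)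
    obtain q y where q: "strict_mono (q :: nat \<Rightarrow> nat)" "mat_lim n 1 (\<lambda>k. snd (X (r (q k)))) y" "y \<in> orth_unit n j v"
      using orth_unit_subseq[of j v n "\<lambda>k. snd (X (r k))"] v X by (auto simp: mem_Times_iff)
    have "(\<lambda>k. ip (fst (X (r (q k)))) (M * snd (X (r (q k))))) \<longlonglongrightarrow> ip x (M * y)"
      using mat_lim_ip[OF mat_lim_subseq[OF r(2) q(1)] mat_lim_mult[OF mat_lim_const[OF M] q(2)]] .
    then show ?thesis
      using strict_mono_o[OF r(1) q(1)] r(3) q(3)
      by (intro exI[of _ "r \<circ> q"] exI[of _ "(x, y)"]) (auto simp: case_prod_unfold)
  qed
  ultimately obtain z where z: "z \<in> ?S"
      and zmax: "\<forall>z'\<in>?S. (case z' of (x, y) \<Rightarrow> ip x (M * y)) \<le> (case z of (x, y) \<Rightarrow> ip x (M * y))"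
    using attains_max_of_subseq[of ?S "\<lambda>(x, y). ip x (M * y)"] by blast
  obtain x y where xy: "z = (x, y)" "x \<in> orth_unit m j u" "y \<in> orth_unit n j v" using z by auto
  define \<sigma> where "\<sigma> = ip x (M * y)"
  have max: "ip x' (M * y') \<le> \<sigma>" if "x' \<in> orth_unit m j u" "y' \<in> orth_unit n j v" for x' y'
    using zmax that by (auto simp: xy(1) \<sigma>_def)
  have xc: "x \<in> carrier_mat m 1" and yc: "y \<in> carrier_mat n 1"
    using xy by (auto simp: orth_unit_def)
  \<comment> \<open>With \<open>x\<close> also its negative is admissible, so the maximum \<sigma>
    is at least -\<sigma> and cannot be negative.\<close>
  have "(-1) \<cdot>\<^sub>m x \<in> orth_unit m j u"
    using xy(2) by (auto simp: orth_unit_def ip_smult_left ip_smult_right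
        u[THEN carrier_matD(1)] u[THEN carrier_matD(2)])
  from max[OF this xy(3)] have \<sigma>0: "0 \<le> \<sigma>" by (simp add: ip_smult_left \<sigma>_def)
  have swap: "ip y (M\<^sup>T * x') = ip x' (M * y)" if "x' \<in> carrier_mat m 1" for x'
    using ip_adjoint[of M x' y] ip_commute[of x' "M * y"] M yc that by simp
  have "ip (v i) (M\<^sup>T * x) = 0" if "i < j" for i
  proof -
    have "ip (v i) (M\<^sup>T * x) = ip (M * v i) x"
      using M xc v[OF that] by (intro ip_adjoint[symmetric]) auto
    also have "\<dots> = 0" using that xy(2) by (simp add: Mv ip_smult_left orth_unit_def)
    finally show ?thesis .
  qed
  then have 1: "M\<^sup>T * x = \<sigma> \<cdot>\<^sub>m y"
    using xy(2,3) \<sigma>0 v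
    by (intro maximizer_singular_pair[OF M xc yc, where j = j and v = v])
      (auto simp: orth_unit_def \<sigma>_def[symmetric] intro!: max)
  have "ip (u i) (M * y) = 0" if "i < j" for i
  proof -
    have "ip (u i) (M * y) = ip (M\<^sup>T * u i) y"
      using ip_adjoint[of "M\<^sup>T" y "u i"] M yc u[OF that] by simp
    also have "\<dots> = 0" using that xy(3) by (simp add: Mu ip_smult_left orth_unit_def)
    finally show ?thesis .
  qed
  then have 2: "M\<^sup>T\<^sup>T * y = \<sigma> \<cdot>\<^sub>m x"
    using xy(2,3) \<sigma>0 u M swap
    by (intro maximizer_singular_pair[of "M\<^sup>T" n m y x, where j = j and v = u])
      (auto simp: orth_unit_def xc yc \<sigma>_def[symmetric] intro!: max)
  show ?thesis
    by (rule bexI[of _ x], rule bexI[of _ y], rule exI[of _ \<sigma>])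
      (use 1 2 \<sigma>0 max xy in simp_all)
qed

text \<open>The maximality clause is carried through the induction because the order of the singular
  values is read off from it later.\<close>

lemma exists_singular_system:
  assumes M: "M \<in> carrier_mat m n" and r: "r \<le> m" "r \<le> n"
  shows "\<exists>u v s. \<forall>j<r. u j \<in> orth_unit m j u \<and> v j \<in> orth_unit n j v \<and> 0 \<le> s j \<and>
    M * v j = s j \<cdot>\<^sub>m u j \<and> M\<^sup>T * u j = s j \<cdot>\<^sub>m v j \<and>
    (\<forall>x\<in>orth_unit m j u. \<forall>y\<in>orth_unit n j v. ip x (M * y) \<le> s j)"
  using r
proof (induction r)
  case 0
  show ?case by simp
next
  case (Suc r)
  then obtain u v s where IH: "\<And>j. j < r \<Longrightarrow> u j \<in> orth_unit m j u \<and> v j \<in> orth_unit n j v \<and> 0 \<le> s j \<and>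
    M * v j = s j \<cdot>\<^sub>m u j \<and> M\<^sup>T * u j = s j \<cdot>\<^sub>m v j \<and>
    (\<forall>x\<in>orth_unit m j u. \<forall>y\<in>orth_unit n j v. ip x (M * y) \<le> s j)"
    by auto
  have "\<exists>x\<in>orth_unit m r u. \<exists>y\<in>orth_unit n r v. \<exists>\<sigma>\<ge>0. M * y = \<sigma> \<cdot>\<^sub>m x \<and> M\<^sup>T * x = \<sigma> \<cdot>\<^sub>m y \<and>
    (\<forall>x'\<in>orth_unit m r u. \<forall>y'\<in>orth_unit n r v. ip x' (M * y') \<le> \<sigma>)"
    by (rule exists_next_singular_pair[OF M, where s = s]) (use Suc.prems IH in \<open>auto simp: orth_unit_def\<close>)
  then obtain x y \<sigma> where new: "x \<in> orth_unit m r u" "y \<in> orth_unit n r v" "0 \<le> \<sigma>"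
      "M * y = \<sigma> \<cdot>\<^sub>m x" "M\<^sup>T * x = \<sigma> \<cdot>\<^sub>m y"
      "\<forall>x'\<in>orth_unit m r u. \<forall>y'\<in>orth_unit n r v. ip x' (M * y') \<le> \<sigma>"
    by blast
  define u' v' s' where "u' = u(r := x)" and "v' = v(r := y)" and "s' = s(r := \<sigma>)"
  \<comment> \<open>\<open>orth_unit\<close> at index \<open>j\<close> looks only at smaller
    indices, so changing the sequences at \<open>r\<close> leaves the constraints for
    \<open>j \<le> r\<close> as they were.\<close>
  have upd: "u' r = x" "v' r = y" "s' r = \<sigma>" "j < r \<Longrightarrow> u' j = u j" "j < r \<Longrightarrow> v' j = v j" "j < r \<Longrightarrow> s' j = s j"
      "j \<le> r \<Longrightarrow> orth_unit k j u' = orth_unit k j u" "j \<le> r \<Longrightarrow> orth_unit k j v' = orth_unit k j v" for j k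
    by (auto simp: u'_def v'_def s'_def orth_unit_def)
  show ?case
    by (rule exI[of _ u'], rule exI[of _ v'], rule exI[of _ s'])
      (use IH new in \<open>auto simp: less_Suc_eq upd\<close>)
qed

text \<open>With \<open>r = min m n\<close> pairs one of \<open>Q\<close> and \<open>P\<close> is
  square, hence orthogonal on both sides. The equations \<open>M * Q = P * S\<close> and
  \<open>M\<^sup>T * P = Q * S\<close> then give the decomposition from
  \<open>M = M * (Q * Q\<^sup>T)\<close> or from \<open>M = P * P\<^sup>T * M\<close>. Zero singular
  values are no exception, since the maximizers are unit vectors in any case.\<close>

lemma exists_svd: "\<exists>P S Q. is_svd M P S Q"
proof -
  define m n r where "m = dim_row M" and "n = dim_col M" and "r = min m n"
  have M: "M \<in> carrier_mat m n" by (simp add: m_def n_def)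
  obtain u v s where uvs: "\<And>j. j < r \<Longrightarrow> u j \<in> orth_unit m j u \<and> v j \<in> orth_unit n j v \<and> 0 \<le> s j \<and>
    M * v j = s j \<cdot>\<^sub>m u j \<and> M\<^sup>T * u j = s j \<cdot>\<^sub>m v j \<and>
    (\<forall>x\<in>orth_unit m j u. \<forall>y\<in>orth_unit n j v. ip x (M * y) \<le> s j)"
    using exists_singular_system[OF M, of r] by (auto simp: r_def)
  have uc: "u j \<in> carrier_mat m 1" and vc: "v j \<in> carrier_mat n 1" if "j < r" for j
    using uvs[OF that] by (auto simp: orth_unit_def)
  \<comment> \<open>The later pair \<open>j\<close> is admissible in the maximization for
    \<open>i\<close>, whose maximum is \<open>s i\<close>.\<close>
  have dec: "s j \<le> s i" if "i \<le> j" "j < r" for i j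
  proof -
    have "u j \<in> orth_unit m i u" "v j \<in> orth_unit n i v"
      using uvs[OF that(2)] that(1) by (auto simp: orth_unit_def)
    then have "ip (u j) (M * v j) \<le> s i"
      using uvs[of i] that by auto
    moreover have "ip (u j) (M * v j) = s j"
      using uvs[OF that(2)] by (auto simp: ip_smult_right orth_unit_def)
    ultimately show ?thesis by simp
  qed
  define cols where "cols k w = mat k r (\<lambda>(a, j). w j $$ (a, 0))" for k and w :: "nat \<Rightarrow> real mat"
  have cols: "cols k w \<in> carrier_mat k r" for k w by (simp add: cols_def)
  have orth: "orthonormal_cols (cols k w)" if w: "\<And>j. j < r \<Longrightarrow> w j \<in> orth_unit k j w" for k w
    unfolding orthonormal_cols_def
  proof (rule eq_matI)
    fix i j assume "i < dim_row (1\<^sub>m (dim_col (cols k w)) :: real mat)" "j < dim_col (1\<^sub>m (dim_col (cols k w)) :: real mat)"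
    then have ij: "i < r" "j < r" by (auto simp: cols_def)
    have "((cols k w)\<^sup>T * cols k w) $$ (i, j) = ip (w i) (w j)"
      using ij w[OF ij(1)] by (simp add: orth_unit_def ip_sum[of _ k 1] cols_def scalar_prod_def atLeast0LessThan)
    also have "\<dots> = (if i = j then 1 else 0)"
      using w[OF ij(1)] w[OF ij(2)] ip_commute[of "w i" "w j"]
      by (cases i j rule: linorder_cases) (auto simp: orth_unit_def)
    finally show "((cols k w)\<^sup>T * cols k w) $$ (i, j) = 1\<^sub>m (dim_col (cols k w)) $$ (i, j)"
      using ij by (simp add: cols_def)
  qed (simp_all add: cols_def)
  define P where "P = cols m u"
  define Q where "Q = cols n v"
  define S where "S = mat_diag r s"
  have PQS: "P \<in> carrier_mat m r" "Q \<in> carrier_mat n r" "S \<in> carrier_mat r r"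
    by (auto simp: P_def Q_def S_def cols_def)
  have oP: "orthonormal_cols P" and oQ: "orthonormal_cols Q"
    using uvs by (auto simp: P_def Q_def intro!: orth)
  have mult_cols: "N * cols a w = cols b w' * S"
    if N: "N \<in> carrier_mat b a" and w: "\<And>j. j < r \<Longrightarrow> w j \<in> carrier_mat a 1" "\<And>j. j < r \<Longrightarrow> w' j \<in> carrier_mat b 1"
      and eq: "\<And>j. j < r \<Longrightarrow> N * w j = s j \<cdot>\<^sub>m w' j" for N a b w w'
  proof (rule eq_matI)
    fix i j assume "i < dim_row (cols b w' * S)" "j < dim_col (cols b w' * S)"
    then have ij: "i < b" "j < r" by (auto simp: cols_def S_def mat_diag_def)
    have "(N * cols a w) $$ (i, j) = (N * w j) $$ (i, 0)"
      using ij N w(1)[OF ij(2)] by (auto simp: cols_def scalar_prod_def intro!: sum.cong)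
    also have "\<dots> = w' j $$ (i, 0) * s j"
      using ij w(2)[OF ij(2)] by (simp add: eq)
    also have "\<dots> = (cols b w' * S) $$ (i, j)"
      unfolding S_def using ij by (subst mat_diag_mult_right[of _ b]) (auto simp: cols_def)
    finally show "(N * cols a w) $$ (i, j) = (cols b w' * S) $$ (i, j)" .
  qed (use N in \<open>auto simp: cols_def S_def mat_diag_def\<close>)
  have MQ: "M * Q = P * S" unfolding P_def Q_def using M uvs uc vc by (intro mult_cols) auto
  have MP: "M\<^sup>T * P = Q * S" unfolding P_def Q_def using M uvs uc vc by (intro mult_cols) auto
  have ST: "S\<^sup>T = S" by (auto simp: S_def mat_diag_def)
  have "M = P * S * Q\<^sup>T"
  proof (cases "n \<le> m")
    case True
    then have "Q \<in> carrier_mat n n" using PQS by (simp add: r_def)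
    then have "Q * Q\<^sup>T = 1\<^sub>m n"
      using oQ by (intro mat_mult_left_right_inverse[of "Q\<^sup>T" n Q]) (auto simp: orthonormal_cols_def)
    then have "M * (Q * Q\<^sup>T) = M" using M by simp
    then show ?thesis using M PQS by (simp add: mat_assoc flip: MQ)
  next
    case False
    then have "P \<in> carrier_mat m m" using PQS by (simp add: r_def)
    then have "P * P\<^sup>T = 1\<^sub>m m"
      using oP by (intro mat_mult_left_right_inverse[of "P\<^sup>T" m P]) (auto simp: orthonormal_cols_def)
    then have "P * P\<^sup>T * M = M" using M by simp
    moreover have "P\<^sup>T * M = S * Q\<^sup>T"
      using arg_cong[OF MP, of transpose_mat] M PQS by (simp add: mat_transpose_mult ST)
    ultimately show ?thesis using M PQS by (simp add: mat_assoc)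
  qed
  moreover have "diagonal_mat S" by (auto simp: S_def mat_diag_def diagonal_mat_def)
  ultimately have "is_svd M P S Q"
    unfolding is_svd_def Let_def m_def[symmetric] n_def[symmetric] r_def[symmetric]
    using PQS oP oQ dec uvs by (auto simp: S_def mat_diag_def)
  then show ?thesis by blast
qed

section \<open>Optimality of leading singular vectors\<close>

text \<open>Let \<open>d\<close> be the difference between \<open>w\<close> and the indicator of the
  first \<open>k\<close> indices: it is at most 0 on these and at least 0 beyond. Replacing
  \<open>t i\<close> by the threshold \<open>t (k - 1)\<close> therefore only increases each
  \<open>t i * d i\<close>, and the bound on the total weight makes the resulting sum
  nonpositive.\<close>

lemma weighted_sum_le_top:
  fixes t w :: "nat \<Rightarrow> real"
  assumes k: "1 \<le> k" "k \<le> r" and t: "\<And>i. i < r \<Longrightarrow> 0 \<le> t i" "\<And>i j. i \<le> j \<Longrightarrow> j < r \<Longrightarrow> t j \<le> t i"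
    and w: "\<And>i. i < r \<Longrightarrow> 0 \<le> w i" "\<And>i. i < r \<Longrightarrow> w i \<le> 1" "(\<Sum>i<r. w i) \<le> real k"
  shows "(\<Sum>i<r. t i * w i) \<le> (\<Sum>i<r. t i * (if i < k then 1 else 0))"
proof -
  define d where "d i = w i - (if i < k then 1 else 0)" for i
  have "t i * d i \<le> t (k - 1) * d i" if "i < r" for i
  proof (cases "i < k")
    case True
    then have "t (k - 1) \<le> t i" "d i \<le> 0" using t(2)[of i "k - 1"] w(2)[OF that] k by (auto simp: d_def)
    then show ?thesis by (rule mult_right_mono_neg)
  next
    case False
    then have "t i \<le> t (k - 1)" "0 \<le> d i" using t(2)[of "k - 1" i] w(1)[OF that] that by (auto simp: d_def)
    then show ?thesis by (rule mult_right_mono)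
  qed
  then have "(\<Sum>i<r. t i * d i) \<le> (\<Sum>i<r. t (k - 1) * d i)" by (intro sum_mono) auto
  also have "\<dots> = t (k - 1) * ((\<Sum>i<r. w i) - (\<Sum>i<r. if i < k then 1 else 0))"
    by (simp add: d_def sum_distrib_left sum_subtractf right_diff_distrib)
  also have "(\<Sum>i<r. if i < k then 1 else 0) = (\<Sum>i<k. 1 :: real)"
    using k by (intro sum.mono_neutral_cong_right) auto
  also have "t (k - 1) * ((\<Sum>i<r. w i) - (\<Sum>i<k. 1)) \<le> 0"
    using t(1)[of "k - 1"] w(3) k by (intro mult_nonneg_nonpos) auto
  finally show ?thesis by (simp add: d_def right_diff_distrib sum_subtractf)
qed

text \<open>In the basis of left singular vectors \<open>fsq (W\<^sup>T * M)\<close> is a weighted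
  sum of squared singular values, where the weight of \<open>i\<close> is the squared length of
  \<open>W\<^sup>T\<close> applied to column \<open>i\<close> of \<open>P\<close>. Each weight is at
  most 1 because \<open>W\<^sup>T\<close> is a contraction, and the weights sum to at most
  \<open>fsq W\<close>, which is \<open>k\<close>. For \<open>first_cols k P\<close> they are 1 on
  the first \<open>k\<close> indices and 0 beyond, the extremal choice.\<close>

lemma ky_fan:
  assumes svd: "is_svd M P S Q" and M: "M \<in> carrier_mat m n" and k: "1 \<le> k" "k \<le> m" "k \<le> n"
    and W: "W \<in> carrier_mat m k" "orthonormal_cols W"
  shows "fsq (W\<^sup>T * M) \<le> fsq ((first_cols k P)\<^sup>T * M)"
proof -
  define r where "r = min m n"
  define t where "t i = (S $$ (i, i))\<^sup>2" for i
  have P: "P \<in> carrier_mat m r" "orthonormal_cols P" and Q: "Q \<in> carrier_mat n r" "orthonormal_cols Q"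
    and S: "S \<in> carrier_mat r r" "diagonal_mat S" and MPSQ: "M = P * S * Q\<^sup>T"
    and t: "\<And>i. i < r \<Longrightarrow> 0 \<le> t i" "\<And>i j. i \<le> j \<Longrightarrow> j < r \<Longrightarrow> t j \<le> t i"
    using svd M by (auto simp: is_svd_def Let_def r_def t_def intro!: power_mono)
  have kr: "k \<le> r" using k by (simp add: r_def)
  define w where "w X i = (\<Sum>c<k. ((X\<^sup>T * P) $$ (c, i))\<^sup>2)" for X i
  have expand: "fsq (X\<^sup>T * M) = (\<Sum>i<r. t i * w X i)" if X: "X \<in> carrier_mat m k" for X
  proof -
    define T where "T = X\<^sup>T * P"
    have T: "T \<in> carrier_mat k r" using X P by (simp add: T_def)
    have TS: "(T * S) $$ (c, i) = T $$ (c, i) * S $$ (i, i)" if "c < k" "i < r" for c i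
    proof -
      have "(T * S) $$ (c, i) = (\<Sum>j<r. T $$ (c, j) * S $$ (j, i))"
        using T S that index_mult_sum[of c T i S] by auto
      also have "\<dots> = (\<Sum>j<r. if j = i then T $$ (c, i) * S $$ (i, i) else 0)"
        using S that by (intro sum.cong) (auto simp: diagonal_mat_def)
      finally show ?thesis using that by simp
    qed
    have "X\<^sup>T * M = T * S * Q\<^sup>T"
      using X P S Q by (simp add: MPSQ T_def mat_assoc)
    then have "fsq (X\<^sup>T * M) = fsq (T * S)"
      using fsq_mult_orthonormal_right[of Q "T * S"] Q S T by simp
    also have "\<dots> = (\<Sum>c<k. \<Sum>i<r. (T * S) $$ (c, i) * (T * S) $$ (c, i))"
      using T S by (intro ip_sum) simp
    also have "\<dots> = (\<Sum>c<k. \<Sum>i<r. t i * (T $$ (c, i))\<^sup>2)"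
      by (intro sum.cong) (auto simp: TS t_def power2_eq_square)
    also have "\<dots> = (\<Sum>i<r. \<Sum>c<k. t i * (T $$ (c, i))\<^sup>2)" by (rule sum.swap)
    finally show ?thesis by (simp add: w_def T_def sum_distrib_left)
  qed
  have "w W i \<le> 1" if i: "i < r" for i
  proof -
    define p where "p = mat m 1 (\<lambda>(a, _). P $$ (a, i))"
    have p: "p \<in> carrier_mat m 1" by (simp add: p_def)
    have "(W\<^sup>T * p) $$ (c, 0) = (W\<^sup>T * P) $$ (c, i)" if "c < k" for c
      using that i W P by (auto simp: p_def scalar_prod_def intro!: sum.cong)
    then have "w W i = fsq (W\<^sup>T * p)"
      using ip_sum[of "W\<^sup>T * p" k 1] W p by (simp add: w_def power2_eq_square)
    also have "\<dots> \<le> fsq p" using W p by (intro fsq_transpose_mult_le) auto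
    also have "\<dots> = (P\<^sup>T * P) $$ (i, i)"
      using i P by (simp add: ip_sum[OF p] scalar_prod_def atLeast0LessThan) (simp add: p_def)
    also have "\<dots> = 1" using P i by (simp add: orthonormal_cols_def)
    finally show ?thesis .
  qed
  moreover have "(\<Sum>i<r. w W i) \<le> k"
  proof -
    have "(\<Sum>i<r. w W i) = (\<Sum>c<k. \<Sum>i<r. ((W\<^sup>T * P) $$ (c, i))\<^sup>2)"
      unfolding w_def by (rule sum.swap)
    also have "\<dots> = fsq (W\<^sup>T * P)"
      using ip_sum[of "W\<^sup>T * P" k r] W P by (simp add: power2_eq_square)
    also have "\<dots> \<le> fsq W\<^sup>T" using P W by (intro fsq_mult_le) auto
    also have "\<dots> = k" using W by (simp add: fsq_transpose fsq_orthonormal_cols)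
    finally show ?thesis .
  qed
  ultimately have "(\<Sum>i<r. t i * w W i) \<le> (\<Sum>i<r. t i * (if i < k then 1 else 0))"
    using kr k t by (intro weighted_sum_le_top) (auto simp: w_def intro: sum_nonneg)
  also have "\<dots> = (\<Sum>i<r. t i * w (first_cols k P) i)"
  proof (intro sum.cong refl)
    fix i assume i: "i \<in> {..<r}"
    have "((first_cols k P)\<^sup>T * P) $$ (c, i) = (P\<^sup>T * P) $$ (c, i)" if "c < k" for c
      using that i kr P by (simp add: scalar_prod_def first_cols_def)
    also have "(P\<^sup>T * P) $$ (c, i) = (if c = i then 1 else 0)" if "c < k" for c
      using that i kr P by (simp add: orthonormal_cols_def)
    finally have "w (first_cols k P) i = (\<Sum>c<k. if c = i then 1 else 0)"
      unfolding w_def by (intro sum.cong) auto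
    also have "\<dots> = (if i < k then 1 else 0)" by simp
    finally show "t i * (if i < k then 1 else 0) = t i * w (first_cols k P) i" by simp
  qed
  finally have le: "(\<Sum>i<r. t i * w W i) \<le> (\<Sum>i<r. t i * w (first_cols k P) i)" .
  have "first_cols k P \<in> carrier_mat m k" using P by (simp add: first_cols_def)
  with le W show ?thesis by (simp add: expand)
qed

lemma orthonormal_first_cols:
  assumes "P \<in> carrier_mat m r" "orthonormal_cols P" "k \<le> r"
  shows "first_cols k P \<in> carrier_mat m k" "orthonormal_cols (first_cols k P)"
proof -
  show "first_cols k P \<in> carrier_mat m k" using assms by (simp add: first_cols_def)
  show "orthonormal_cols (first_cols k P)"
    unfolding orthonormal_cols_def
  proof (rule eq_matI)
    fix i j assume "i < dim_row (1\<^sub>m (dim_col (first_cols k P)) :: real mat)"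
      "j < dim_col (1\<^sub>m (dim_col (first_cols k P)) :: real mat)"
    then have ij: "i < k" "j < k" by (auto simp: first_cols_def)
    then have "((first_cols k P)\<^sup>T * first_cols k P) $$ (i, j) = (P\<^sup>T * P) $$ (i, j)"
      using assms(1,3) by (simp add: first_cols_def scalar_prod_def)
    also have "P\<^sup>T * P = 1\<^sub>m r"
      using assms(1,2) by (simp add: orthonormal_cols_def)
    finally show "((first_cols k P)\<^sup>T * first_cols k P) $$ (i, j) = 1\<^sub>m (dim_col (first_cols k P)) $$ (i, j)"
      using ij assms(3) by (simp add: first_cols_def)
  qed (simp_all add: first_cols_def)
qed

text \<open>A diagonal \<open>S\<close> is symmetric, so transposing exchanges \<open>P\<close> and
  \<open>Q\<close>. This reduces the treatment of block columns to that of block rows.\<close>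

lemma is_svd_transpose:
  assumes "is_svd M P S Q"
  shows "is_svd M\<^sup>T Q S P"
proof -
  let ?r = "min (dim_row M) (dim_col M)"
  have P: "P \<in> carrier_mat (dim_row M) ?r" and Q: "Q \<in> carrier_mat (dim_col M) ?r"
    and S: "S \<in> carrier_mat ?r ?r" "diagonal_mat S" and M: "M = P * S * Q\<^sup>T"
    using assms unfolding is_svd_def Let_def by blast+
  have "S\<^sup>T = S"
  proof (rule eq_matI)
    fix i j assume "i < dim_row S" "j < dim_col S"
    then show "S\<^sup>T $$ (i, j) = S $$ (i, j)"
      using S by (cases "i = j") (auto simp: diagonal_mat_def)
  qed (use S in auto)
  then have "(P * S * Q\<^sup>T)\<^sup>T = Q * S * P\<^sup>T"
    using P Q S(1) by (simp add: mat_transpose_mult mat_assoc)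
  then have "M\<^sup>T = Q * S * P\<^sup>T" using M by simp
  then show ?thesis
    using assms P Q S
    unfolding is_svd_def Let_def index_transpose_mat(2,3) min.commute[of "dim_col M" "dim_row M"] by blast
qed

text \<open>A thin decomposition already has this shape with \<open>R = S * Q\<^sup>T\<close>, and
  the columns of \<open>P\<close> are orthonormal even if \<open>M\<close> is rank deficient.
  \<open>R\<close> is not triangular in general; only its size matters.\<close>

lemma exists_qr:
  assumes "M \<in> carrier_mat m k" "k \<le> m"
  shows "\<exists>Q R. Q \<in> carrier_mat m k \<and> orthonormal_cols Q \<and> R \<in> carrier_mat k k \<and> M = Q * R"
proof -
  obtain P S Q where svd: "is_svd M P S Q" using exists_svd by blast
  then have "P \<in> carrier_mat m k" "orthonormal_cols P" "S \<in> carrier_mat k k" "Q \<in> carrier_mat k k" "M = P * S * Q\<^sup>T"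
    using assms by (auto simp: is_svd_def Let_def min_def split: if_splits)
  then show ?thesis by (intro exI[of _ P] exI[of _ "S * Q\<^sup>T"]) (auto simp: mat_assoc)
qed

section \<open>Block-diagonal matrices\<close>

text \<open>A closed form with \<open>div\<close> and \<open>mod\<close> for the recursive
  \<open>diag_block_mat\<close>, with explicit block sizes: entries are computed without induction
  over a list of blocks.\<close>

definition blockdiag :: "nat \<Rightarrow> nat \<Rightarrow> nat \<Rightarrow> (nat \<Rightarrow> 'a::zero mat) \<Rightarrow> 'a mat" where
  "blockdiag n p q W = mat (n * p) (n * q)
     (\<lambda>(a, b). if a div p = b div q then W (a div p) $$ (a mod p, b mod q) else 0)"

lemma blockdiag_carrier [simp]: "blockdiag n p q W \<in> carrier_mat (n * p) (n * q)"
  by (simp add: blockdiag_def)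

lemma blockdiag_dim [simp]: "dim_row (blockdiag n p q W) = n * p" "dim_col (blockdiag n p q W) = n * q"
  by (simp_all add: blockdiag_def)

lemma block_index_less:
  fixes i n p a :: nat
  assumes "i < n" "a < p"
  shows "i * p + a < n * p"
proof -
  have "i * p + a < Suc i * p" using assms by simp
  also have "\<dots> \<le> n * p" using assms by (intro mult_right_mono) auto
  finally show ?thesis .
qed

lemma index_blockdiag:
  assumes "i < n" "a < p" "j < n" "b < q"
  shows "blockdiag n p q W $$ (i * p + a, j * q + b) = (if i = j then W i $$ (a, b) else 0)"
  using assms by (auto simp: blockdiag_def block_index_less)

lemma block_index_cases:
  fixes c n p :: nat
  assumes "c < n * p"
  obtains i a where "c = i * p + a" "i < n" "a < p"
proof
  have "0 < p" using assms by (cases p) auto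
  then show "c = c div p * p + c mod p" "c div p < n" "c mod p < p"
    using assms by (auto simp: less_mult_imp_div_less)
qed

lemma blockdiag_eqI:
  assumes "M \<in> carrier_mat (n * p) (n * q)"
    and "\<And>i a j b. i < n \<Longrightarrow> a < p \<Longrightarrow> j < n \<Longrightarrow> b < q \<Longrightarrow>
      M $$ (i * p + a, j * q + b) = (if i = j then W i $$ (a, b) else 0)"
  shows "M = blockdiag n p q W"
proof (rule eq_matI)
  fix c d assume "c < dim_row (blockdiag n p q W)" "d < dim_col (blockdiag n p q W)"
  then obtain i a j b where "c = i * p + a" "i < n" "a < p" "d = j * q + b" "j < n" "b < q"
    by (metis block_index_cases blockdiag_dim)
  then show "M $$ (c, d) = blockdiag n p q W $$ (c, d)"
    using assms(2)[of i a j b] by (simp add: index_blockdiag)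
qed (use assms(1) in auto)

lemma diag_block_mat_eq_blockdiag:
  assumes "\<And>W. W \<in> set Ws \<Longrightarrow> W \<in> carrier_mat p q" "length Ws = n"
  shows "diag_block_mat Ws = blockdiag n p q (\<lambda>i. Ws ! i)"
  using assms
proof (induction Ws arbitrary: n)
  case Nil
  then show ?case by (intro eq_matI) auto
next
  case (Cons A Ws)
  let ?n = "length Ws"
  have IH: "diag_block_mat Ws = blockdiag ?n p q (\<lambda>i. Ws ! i)" using Cons by simp
  have A: "A \<in> carrier_mat p q" using Cons.prems by simp
  have n: "n = Suc ?n" using Cons.prems by simp
  show ?case
  proof (rule eq_matI)
    fix c d assume "c < dim_row (blockdiag n p q (\<lambda>i. (A # Ws) ! i))" "d < dim_col (blockdiag n p q (\<lambda>i. (A # Ws) ! i))"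
    then have cd: "c < p + ?n * p" "d < q + ?n * q" by (auto simp: n)
    have pq: "0 < p" "0 < q" using cd by (cases p; cases q; auto)+
    show "diag_block_mat (A # Ws) $$ (c, d) = blockdiag n p q (\<lambda>i. (A # Ws) ! i) $$ (c, d)"
      using cd pq carrier_matD[OF A]
      by (cases "c < p"; cases "d < q")
        (auto simp: Let_def IH n blockdiag_def le_div_geq le_mod_geq)
  qed (use A in \<open>auto simp: Let_def IH n\<close>)
qed

lemma sum_blocks: "(\<Sum>c<n * q. f c) = (\<Sum>j<n. \<Sum>b<q. f (j * q + b))" for f :: "nat \<Rightarrow> 'a::comm_monoid_add"
proof -
  have "(\<Sum>b=j * q..<j * q + q. f b) = (\<Sum>b<q. f (j * q + b))" for j
    using sum.shift_bounds_nat_ivl[of f 0 "j * q" q] by (simp add: atLeast0LessThan add.commute)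
  then show ?thesis by (simp add: sum.nat_group[symmetric])
qed

lemma index_blockdiag_mult:
  fixes W :: "nat \<Rightarrow> 'a::semiring_0 mat"
  assumes "X \<in> carrier_mat (n * q) m" "i < n" "a < p" "b < m"
  shows "(blockdiag n p q W * X) $$ (i * p + a, b) = (\<Sum>c<q. W i $$ (a, c) * X $$ (i * q + c, b))"
proof -
  have "(blockdiag n p q W * X) $$ (i * p + a, b)
      = (\<Sum>c<n * q. blockdiag n p q W $$ (i * p + a, c) * X $$ (c, b))"
    using assms block_index_less[OF assms(2,3)] index_mult_sum[of "i * p + a" "blockdiag n p q W" b X] by simp
  also have "\<dots> = (\<Sum>j<n. \<Sum>c<q. (if i = j then W i $$ (a, c) else 0) * X $$ (j * q + c, b))"
    using assms by (simp add: sum_blocks index_blockdiag)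
  also have "\<dots> = (\<Sum>j<n. if j = i then \<Sum>c<q. W i $$ (a, c) * X $$ (i * q + c, b) else 0)"
    by (intro sum.cong) auto
  finally show ?thesis using assms by simp
qed

lemma blockdiag_mult:
  fixes W W' :: "nat \<Rightarrow> 'a::semiring_0 mat"
  assumes "\<And>i. i < n \<Longrightarrow> W i \<in> carrier_mat p q" "\<And>i. i < n \<Longrightarrow> W' i \<in> carrier_mat q r"
  shows "blockdiag n p q W * blockdiag n q r W' = blockdiag n p r (\<lambda>i. W i * W' i)"
proof (rule blockdiag_eqI)
  fix i a j b assume *: "i < n" "a < p" "j < n" "b < r"
  show "(blockdiag n p q W * blockdiag n q r W') $$ (i * p + a, j * r + b) = (if i = j then (W i * W' i) $$ (a, b) else 0)"
    using * assms(1)[OF *(1)] assms(2)[OF *(1)]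
      index_blockdiag_mult[of "blockdiag n q r W'" n q "n * r" i a p "j * r + b" W]
    by (auto simp: block_index_less index_blockdiag scalar_prod_def atLeast0LessThan simp del: index_mult_mat(1))
      (auto simp: scalar_prod_def atLeast0LessThan)
qed auto

lemma blockdiag_transpose:
  assumes "\<And>i. i < n \<Longrightarrow> W i \<in> carrier_mat p q"
  shows "(blockdiag n p q W)\<^sup>T = blockdiag n q p (\<lambda>i. (W i)\<^sup>T)"
proof (rule blockdiag_eqI)
  fix i a j b assume *: "i < n" "a < q" "j < n" "b < p"
  show "(blockdiag n p q W)\<^sup>T $$ (i * q + a, j * p + b) = (if i = j then (W i)\<^sup>T $$ (a, b) else 0)"
    using * assms[OF *(1)] by (auto simp: block_index_less index_blockdiag)
qed simp

lemma blockdiag_one: "1\<^sub>m (n * p) = blockdiag n p p (\<lambda>_. 1\<^sub>m p)"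
proof (rule blockdiag_eqI)
  fix i a j b assume *: "i < n" "a < p" "j < n" "b < p"
  have "(i * p + a = j * p + b) = (i = j \<and> a = b)"
  proof
    assume eq: "i * p + a = j * p + b"
    have "i = (i * p + a) div p" using * by simp
    also have "\<dots> = (j * p + b) div p" by (simp only: eq)
    also have "\<dots> = j" using * by simp
    finally show "i = j \<and> a = b" using eq by simp
  qed simp
  then show "1\<^sub>m (n * p) $$ (i * p + a, j * p + b) = (if i = j then 1\<^sub>m p $$ (a, b) else 0)"
    using * by (simp add: block_index_less)
qed simp

lemma blockdiag_cong:
  assumes "\<And>i. i < n \<Longrightarrow> W i = W' i"
  shows "blockdiag n p q W = blockdiag n p q W'"
  by (rule blockdiag_eqI) (use assms in \<open>simp_all add: index_blockdiag\<close>)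

lemma blockdiag_inject:
  assumes "blockdiag n p q W = blockdiag n p q W'" "i < n" "W i \<in> carrier_mat p q" "W' i \<in> carrier_mat p q"
  shows "W i = W' i"
proof (rule eq_matI)
  fix a b assume "a < dim_row (W' i)" "b < dim_col (W' i)"
  then show "W i $$ (a, b) = W' i $$ (a, b)"
    using assms index_blockdiag[of i n a p i b q W] index_blockdiag[of i n a p i b q W'] by auto
qed (use assms in auto)

lemma orthonormal_cols_blockdiag:
  assumes "\<And>i. i < n \<Longrightarrow> W i \<in> carrier_mat p q"
  shows "orthonormal_cols (blockdiag n p q W) \<longleftrightarrow> (\<forall>i<n. orthonormal_cols (W i))"
proof -
  have "orthonormal_cols (blockdiag n p q W) \<longleftrightarrow>
      blockdiag n q q (\<lambda>i. (W i)\<^sup>T * W i) = blockdiag n q q (\<lambda>_. 1\<^sub>m q)"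
    using assms by (simp add: orthonormal_cols_def blockdiag_transpose blockdiag_mult blockdiag_one)
  also have "\<dots> \<longleftrightarrow> (\<forall>i<n. (W i)\<^sup>T * W i = 1\<^sub>m q)"
  proof
    assume eq: "blockdiag n q q (\<lambda>i. (W i)\<^sup>T * W i) = blockdiag n q q (\<lambda>_. 1\<^sub>m q)"
    show "\<forall>i<n. (W i)\<^sup>T * W i = 1\<^sub>m q"
    proof (intro allI impI)
      fix i assume "i < n"
      then show "(W i)\<^sup>T * W i = 1\<^sub>m q"
        using blockdiag_inject[OF eq] mult_carrier_mat[of "(W i)\<^sup>T" q p "W i" q] assms[of i] by simp
    qed
  qed (auto intro: blockdiag_cong)
  finally show ?thesis using assms[THEN carrier_matD(2)] by (simp add: orthonormal_cols_def)
qed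

section \<open>Block-diagonality as a property of a matrix\<close>

definition is_blockdiag :: "nat \<Rightarrow> nat \<Rightarrow> nat \<Rightarrow> 'a::zero mat \<Rightarrow> bool" where
  "is_blockdiag n p q M \<longleftrightarrow> M \<in> carrier_mat (n * p) (n * q) \<and>
     (\<forall>a<n * p. \<forall>b<n * q. a div p \<noteq> b div q \<longrightarrow> M $$ (a, b) = 0)"

lemma is_blockdiag_iff:
  "is_blockdiag n p q M \<longleftrightarrow> (\<exists>W. (\<forall>i. W i \<in> carrier_mat p q) \<and> M = blockdiag n p q W)"
proof
  assume M: "is_blockdiag n p q M"
  let ?W = "\<lambda>i. mat p q (\<lambda>(a, b). M $$ (i * p + a, i * q + b))"
  have "M = blockdiag n p q ?W"
    by (rule blockdiag_eqI) (use M in \<open>auto simp: is_blockdiag_def block_index_less\<close>)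
  then show "\<exists>W. (\<forall>i. W i \<in> carrier_mat p q) \<and> M = blockdiag n p q W"
    by (intro exI[of _ ?W]) auto
qed (auto simp: is_blockdiag_def blockdiag_def)

lemma is_blockdiag_carrier: "is_blockdiag n p q M \<Longrightarrow> M \<in> carrier_mat (n * p) (n * q)"
  by (simp add: is_blockdiag_def)

lemma is_blockdiag_mult:
  fixes M N :: "'a::semiring_0 mat"
  assumes "is_blockdiag n p q M" "is_blockdiag n q r N"
  shows "is_blockdiag n p r (M * N)"
proof -
  obtain W W' where "\<forall>i. W i \<in> carrier_mat p q" "M = blockdiag n p q W"
    "\<forall>i. W' i \<in> carrier_mat q r" "N = blockdiag n q r W'"
    using assms by (auto simp: is_blockdiag_iff)
  then show ?thesis
    unfolding is_blockdiag_iff by (intro exI[of _ "\<lambda>i. W i * W' i"]) (auto simp: blockdiag_mult intro: mult_carrier_mat)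
qed

lemma is_blockdiag_transpose: "is_blockdiag n p q M \<Longrightarrow> is_blockdiag n q p M\<^sup>T"
  by (auto simp: is_blockdiag_def)

lemma is_blockdiag_minus:
  fixes M N :: "'a::group_add mat"
  assumes "is_blockdiag n p q M" "is_blockdiag n p q N"
  shows "is_blockdiag n p q (M - N)"
  using assms by (auto simp: is_blockdiag_def intro: minus_carrier_mat)

text \<open>The block number for size \<open>s * p\<close> is the one for size \<open>p\<close>
  divided by \<open>s\<close>, so equal fine blocks lie in equal coarse blocks. With
  \<open>s = 2\<close> this passes from k by k blocks to 2 k by 2 k blocks of the same
  matrix.\<close>

lemma is_blockdiag_coarsen:
  assumes "is_blockdiag (n * s) p p M"
  shows "is_blockdiag n (s * p) (s * p) M"
proof -
  have "a div (s * p) = b div (s * p)" if "a div p = b div p" for a b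
    using that by (metis div_mult2_eq mult.commute)
  then show ?thesis
    using assms unfolding is_blockdiag_def mult.assoc[of n s p] by blast
qed

lemma is_blockdiag_qr:
  fixes M :: "real mat"
  assumes "is_blockdiag n p q M" "q \<le> p"
  shows "\<exists>Q R. is_blockdiag n p q Q \<and> orthonormal_cols Q \<and> is_blockdiag n q q R \<and> M = Q * R"
proof -
  obtain W where W: "\<forall>i. W i \<in> carrier_mat p q" "M = blockdiag n p q W"
    using assms(1) by (auto simp: is_blockdiag_iff)
  obtain Q R where QR: "\<And>i. Q i \<in> carrier_mat p q" "\<And>i. orthonormal_cols (Q i)" "\<And>i. R i \<in> carrier_mat q q"
      "\<And>i. W i = Q i * R i"
    using exists_qr[OF W(1)[rule_format] assms(2)] by metis
  have "M = blockdiag n p q Q * blockdiag n q q R"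
    unfolding W(2) using QR by (subst blockdiag_mult) (auto intro!: blockdiag_cong)
  then show ?thesis
    using QR by (intro exI[of _ "blockdiag n p q Q"] exI[of _ "blockdiag n q q R"])
      (auto simp: is_blockdiag_iff orthonormal_cols_blockdiag)
qed

lemma index_conj:
  fixes U X V :: "'a::comm_semiring_0 mat"
  assumes "U \<in> carrier_mat m r" "X \<in> carrier_mat r s" "V \<in> carrier_mat n s" "a < m" "b < n"
  shows "(U * X * V\<^sup>T) $$ (a, b) = (\<Sum>d<s. \<Sum>c<r. U $$ (a, c) * X $$ (c, d) * V $$ (b, d))"
proof -
  have "(U * X * V\<^sup>T) $$ (a, b) = (\<Sum>d<s. (U * X) $$ (a, d) * V $$ (b, d))"
    using assms index_mult_sum[of a "U * X" b "V\<^sup>T"] by simp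
  also have "\<dots> = (\<Sum>d<s. (\<Sum>c<r. U $$ (a, c) * X $$ (c, d)) * V $$ (b, d))"
    using assms index_mult_sum[of a U _ X] by simp
  finally show ?thesis by (simp add: sum_distrib_right)
qed

section \<open>Diagonal blocks and the off-diagonal remainder\<close>

definition diag_part :: "nat \<Rightarrow> 'a::zero mat \<Rightarrow> 'a mat" where
  "diag_part p M = mat (dim_row M) (dim_col M) (\<lambda>(a, b). if a div p = b div p then M $$ (a, b) else 0)"

lemma diag_part_carrier: "M \<in> carrier_mat m n \<Longrightarrow> diag_part p M \<in> carrier_mat m n"
  by (rule carrier_matI) (auto simp: diag_part_def)

lemma diag_part_dim [simp]: "dim_row (diag_part p M) = dim_row M" "dim_col (diag_part p M) = dim_col M"
  by (simp_all add: diag_part_def)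

lemma is_blockdiag_diag_part: "M \<in> carrier_mat (n * p) (n * p) \<Longrightarrow> is_blockdiag n p p (diag_part p M)"
  by (auto simp: is_blockdiag_def diag_part_def)

lemma diag_part_blockdiag:
  assumes "is_blockdiag n p p M"
  shows "diag_part p M = M"
  using assms by (intro eq_matI) (auto simp: is_blockdiag_def diag_part_def)

lemma diag_part_add:
  fixes M N :: "'a::monoid_add mat"
  assumes "M \<in> carrier_mat m n" "N \<in> carrier_mat m n"
  shows "diag_part p (M + N) = diag_part p M + diag_part p N"
  using assms by (intro eq_matI) (auto simp: diag_part_def)

text \<open>Row \<open>a\<close> of \<open>U\<close> is supported on the columns of block
  \<open>a div p\<close>, and likewise for \<open>V\<close>. An entry in block (i, j) of the product
  thus involves only entries of block (i, j) of \<open>X\<close>, so restricting to i = j commutes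
  with the product.\<close>

lemma diag_part_conj:
  fixes U X V :: "'a::comm_semiring_0 mat"
  assumes U: "is_blockdiag n p q U" and V: "is_blockdiag n p q V" and X: "X \<in> carrier_mat (n * q) (n * q)"
  shows "diag_part p (U * X * V\<^sup>T) = U * diag_part q X * V\<^sup>T"
proof (rule eq_matI)
  have Uc: "U \<in> carrier_mat (n * p) (n * q)" and Vc: "V \<in> carrier_mat (n * p) (n * q)"
    using U V by (simp_all add: is_blockdiag_def)
  fix a b assume "a < dim_row (U * diag_part q X * V\<^sup>T)" "b < dim_col (U * diag_part q X * V\<^sup>T)"
  then have ab: "a < n * p" "b < n * p" using Uc Vc by auto
  have "(U * diag_part q X * V\<^sup>T) $$ (a, b)
      = (\<Sum>d<n * q. \<Sum>c<n * q. U $$ (a, c) * diag_part q X $$ (c, d) * V $$ (b, d))"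
    using Uc Vc X ab by (intro index_conj) (auto simp: diag_part_carrier)
  also have "\<dots> = (\<Sum>d<n * q. \<Sum>c<n * q. if a div p = b div p then U $$ (a, c) * X $$ (c, d) * V $$ (b, d) else 0)"
  proof (intro sum.cong refl)
    fix d c assume dc: "d \<in> {..<n * q}" "c \<in> {..<n * q}"
    have zero: "a div p \<noteq> c div q \<Longrightarrow> U $$ (a, c) = 0" "b div p \<noteq> d div q \<Longrightarrow> V $$ (b, d) = 0"
      using U V dc ab by (auto simp: is_blockdiag_def)
    then show "U $$ (a, c) * diag_part q X $$ (c, d) * V $$ (b, d)
        = (if a div p = b div p then U $$ (a, c) * X $$ (c, d) * V $$ (b, d) else 0)"
      using dc X by (cases "a div p = c div q"; cases "b div p = d div q") (auto simp: diag_part_def)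
  qed
  also have "\<dots> = (if a div p = b div p then (U * X * V\<^sup>T) $$ (a, b) else 0)"
    using index_conj[OF Uc X Vc ab] by simp
  also have "\<dots> = diag_part p (U * X * V\<^sup>T) $$ (a, b)"
    using Uc Vc ab by (simp add: diag_part_def)
  finally show "diag_part p (U * X * V\<^sup>T) $$ (a, b) = (U * diag_part q X * V\<^sup>T) $$ (a, b)" ..
qed (use U V in \<open>auto simp: is_blockdiag_def\<close>)

definition off_diag :: "nat \<Rightarrow> 'a::ab_group_add mat \<Rightarrow> 'a mat" where
  "off_diag p M = M - diag_part p M"

lemma off_diag_dim [simp]: "dim_row (off_diag p M) = dim_row M" "dim_col (off_diag p M) = dim_col M"
  by (simp_all add: off_diag_def)

lemma off_diag_carrier: "M \<in> carrier_mat m n \<Longrightarrow> off_diag p M \<in> carrier_mat m n"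
  by (rule carrier_matI) auto

lemma index_off_diag:
  assumes "a < dim_row M" "b < dim_col M"
  shows "off_diag p M $$ (a, b) = (if a div p = b div p then 0 else M $$ (a, b))"
  using assms by (simp add: off_diag_def diag_part_def)

lemma off_diag_minus:
  assumes "M \<in> carrier_mat m n" "N \<in> carrier_mat m n"
  shows "off_diag p (M - N) = off_diag p M - off_diag p N"
proof (rule eq_matI)
  fix a b assume "a < dim_row (off_diag p M - off_diag p N)" "b < dim_col (off_diag p M - off_diag p N)"
  then show "off_diag p (M - N) $$ (a, b) = (off_diag p M - off_diag p N) $$ (a, b)"
    using assms by (auto simp: index_off_diag)
qed (use assms in auto)

lemma fsq_off_diag_le: "fsq (off_diag p M) \<le> fsq M"
  unfolding ip_def by (auto simp: index_off_diag intro!: sum_mono)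

lemma off_diag_transpose: "dim_row M = dim_col M \<Longrightarrow> off_diag p M\<^sup>T = (off_diag p M)\<^sup>T"
  by (intro eq_matI) (auto simp: index_off_diag)

text \<open>Removing the diagonal blocks discards \<open>D\<close> and commutes with the outer
  factors; blocks of size \<open>p\<close> in the product correspond to blocks of size
  \<open>q\<close> in \<open>X\<close>.\<close>

lemma off_diag_conj_add:
  fixes U X V :: "'a::comm_ring mat"
  assumes U: "is_blockdiag n p q U" and V: "is_blockdiag n p q V" and X: "X \<in> carrier_mat (n * q) (n * q)"
    and D: "is_blockdiag n p p D"
  shows "off_diag p (U * X * V\<^sup>T + D) = U * off_diag q X * V\<^sup>T"
proof -
  have c: "U \<in> carrier_mat (n * p) (n * q)" "V \<in> carrier_mat (n * p) (n * q)" "D \<in> carrier_mat (n * p) (n * p)"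
    using U V D by (simp_all add: is_blockdiag_def)
  have "diag_part p (U * X * V\<^sup>T + D) = U * diag_part q X * V\<^sup>T + D"
  proof -
    have "diag_part p (U * X * V\<^sup>T + D) = diag_part p (U * X * V\<^sup>T) + diag_part p D"
      using c X by (intro diag_part_add[of _ "n * p" "n * p"]) auto
    then show ?thesis unfolding diag_part_conj[OF U V X] diag_part_blockdiag[OF D] .
  qed
  moreover have "U * off_diag q X * V\<^sup>T = U * X * V\<^sup>T - U * diag_part q X * V\<^sup>T"
    using c X by (simp add: off_diag_def mat_mult_minus mat_minus_mult)
  ultimately show ?thesis
    unfolding off_diag_def using c X by (intro eq_matI) (auto simp del: index_mult_mat(1))
qed

section \<open>HSS matrices\<close>

definition orth_blockdiag :: "nat \<Rightarrow> nat \<Rightarrow> real mat \<Rightarrow> bool" where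
  "orth_blockdiag n k U \<longleftrightarrow> is_blockdiag n (2 * k) k U \<and> orthonormal_cols U"

text \<open>The condition under the quantifiers of \<open>HSS\<close>, named so that it can be
  established for the factors returned by a run.\<close>

definition factors_ok ::
  "nat \<Rightarrow> nat \<Rightarrow> real mat \<Rightarrow> (nat \<Rightarrow> real mat list) \<Rightarrow> (nat \<Rightarrow> real mat list) \<Rightarrow> (nat \<Rightarrow> real mat list) \<Rightarrow> bool"
where
  "factors_ok L k D0 U V D \<longleftrightarrow> D0 \<in> carrier_mat (2 * k) (2 * k) \<and>
     (\<forall>l\<in>{1..L}.
        length (U l) = 2 ^ l \<and> length (V l) = 2 ^ l \<and> length (D l) = 2 ^ l \<and>
        (\<forall>W\<in>set (U l) \<union> set (V l). W \<in> carrier_mat (2 * k) k \<and> orthonormal_cols W) \<and>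
        (\<forall>W\<in>set (D l). W \<in> carrier_mat (2 * k) (2 * k)))"

lemma HSS_factors_ok: "HSS L k = {telescope D0 U V D L | D0 U V D. factors_ok L k D0 U V D}"
  unfolding HSS_def factors_ok_def by blast

lemma is_blockdiag_diag_block_mat:
  assumes "\<And>W. W \<in> set Ws \<Longrightarrow> W \<in> carrier_mat p q" "length Ws = n"
  shows "is_blockdiag n p q (diag_block_mat Ws)"
proof -
  have "diag_block_mat Ws = blockdiag n p q (\<lambda>i. Ws ! i)"
    using assms by (intro diag_block_mat_eq_blockdiag)
  then show ?thesis by (auto simp: is_blockdiag_def blockdiag_def)
qed

lemma orth_blockdiag_diag_block_mat:
  assumes "\<And>W. W \<in> set Ws \<Longrightarrow> W \<in> carrier_mat (2 * k) k \<and> orthonormal_cols W" "length Ws = n"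
  shows "orth_blockdiag n k (diag_block_mat Ws)"
proof -
  have "diag_block_mat Ws = blockdiag n (2 * k) k (\<lambda>i. Ws ! i)"
    using assms by (intro diag_block_mat_eq_blockdiag) auto
  moreover have "orthonormal_cols (blockdiag n (2 * k) k (\<lambda>i. Ws ! i))"
    using assms by (subst orthonormal_cols_blockdiag) auto
  moreover have "is_blockdiag n (2 * k) k (diag_block_mat Ws)"
    using assms by (intro is_blockdiag_diag_block_mat) auto
  ultimately show ?thesis by (simp add: orth_blockdiag_def)
qed

lemma is_blockdiag_as_list:
  assumes "is_blockdiag n p q M"
  obtains Ws where "length Ws = n" "\<forall>W\<in>set Ws. W \<in> carrier_mat p q" "M = diag_block_mat Ws"
proof -
  obtain W where W: "\<forall>i. W i \<in> carrier_mat p q" "M = blockdiag n p q W"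
    using assms by (auto simp: is_blockdiag_iff)
  have "diag_block_mat (map W [0..<n]) = blockdiag n p q (\<lambda>i. map W [0..<n] ! i)"
    using W(1) by (intro diag_block_mat_eq_blockdiag) auto
  also have "\<dots> = M" unfolding W(2) by (intro blockdiag_cong) simp
  finally show ?thesis using W(1) that[of "map W [0..<n]"] by simp
qed

lemma orth_blockdiag_as_list:
  assumes "orth_blockdiag n k M"
  obtains Ws where "length Ws = n" "\<forall>W\<in>set Ws. W \<in> carrier_mat (2 * k) k \<and> orthonormal_cols W"
    "M = diag_block_mat Ws"
proof -
  obtain Ws where Ws: "length Ws = n" "\<forall>W\<in>set Ws. W \<in> carrier_mat (2 * k) k" "M = diag_block_mat Ws"
    using assms is_blockdiag_as_list by (metis orth_blockdiag_def)
  have "M = blockdiag n (2 * k) k (\<lambda>i. Ws ! i)"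
    unfolding Ws(3) using Ws by (intro diag_block_mat_eq_blockdiag) auto
  then have "\<forall>i<n. orthonormal_cols (Ws ! i)"
    using assms Ws by (simp add: orth_blockdiag_def orthonormal_cols_blockdiag)
  then have "\<forall>W\<in>set Ws. orthonormal_cols W"
    by (auto simp: in_set_conv_nth Ws(1))
  with Ws show ?thesis by (intro that[of Ws]) auto
qed

lemma telescope_cong:
  assumes "\<And>l. l \<in> {1..L} \<Longrightarrow> U l = U' l" "\<And>l. l \<in> {1..L} \<Longrightarrow> V l = V' l" "\<And>l. l \<in> {1..L} \<Longrightarrow> D l = D' l"
  shows "telescope D0 U V D L = telescope D0 U' V' D' L"
  using assms by (induction L) auto

lemma HSS_0: "HSS 0 k = carrier_mat (2 * k) (2 * k)"
  by (auto simp: HSS_def)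

text \<open>The last telescoping step, freed from lists of blocks; the inductions over HSS matrices
  work with this form. For the converse, the coarser factors are extended by a function update at
  \<open>Suc L\<close>, which the coarser recursion does not see.\<close>

lemma HSS_Suc:
  "B \<in> HSS (Suc L) k \<longleftrightarrow> (\<exists>U V X D. orth_blockdiag (2 ^ Suc L) k U \<and> orth_blockdiag (2 ^ Suc L) k V \<and>
     X \<in> HSS L k \<and> is_blockdiag (2 ^ Suc L) (2 * k) (2 * k) D \<and> B = U * X * V\<^sup>T + D)"
proof
  assume "B \<in> HSS (Suc L) k"
  then obtain D0 U V D where ok: "factors_ok (Suc L) k D0 U V D" and B: "B = telescope D0 U V D (Suc L)"
    by (auto simp: HSS_factors_ok)
  have "telescope D0 U V D L \<in> HSS L k"
  proof -
    have "factors_ok L k D0 U V D" using ok unfolding factors_ok_def by auto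
    then show ?thesis unfolding HSS_factors_ok by blast
  qed
  moreover have "orth_blockdiag (2 ^ Suc L) k (diag_block_mat (U (Suc L)))"
      "orth_blockdiag (2 ^ Suc L) k (diag_block_mat (V (Suc L)))"
      "is_blockdiag (2 ^ Suc L) (2 * k) (2 * k) (diag_block_mat (D (Suc L)))"
    using ok by (auto simp: factors_ok_def intro!: orth_blockdiag_diag_block_mat is_blockdiag_diag_block_mat)
  ultimately show "\<exists>U V X D. orth_blockdiag (2 ^ Suc L) k U \<and> orth_blockdiag (2 ^ Suc L) k V \<and>
     X \<in> HSS L k \<and> is_blockdiag (2 ^ Suc L) (2 * k) (2 * k) D \<and> B = U * X * V\<^sup>T + D"
    unfolding B telescope.simps by blast
next
  assume "\<exists>U V X D. orth_blockdiag (2 ^ Suc L) k U \<and> orth_blockdiag (2 ^ Suc L) k V \<and>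
     X \<in> HSS L k \<and> is_blockdiag (2 ^ Suc L) (2 * k) (2 * k) D \<and> B = U * X * V\<^sup>T + D"
  then obtain U V X D where U: "orth_blockdiag (2 ^ Suc L) k U" and V: "orth_blockdiag (2 ^ Suc L) k V"
      and X: "X \<in> HSS L k" and D: "is_blockdiag (2 ^ Suc L) (2 * k) (2 * k) D" and B: "B = U * X * V\<^sup>T + D"
    by blast
  obtain Us where Us: "length Us = 2 ^ Suc L" "\<forall>W\<in>set Us. W \<in> carrier_mat (2 * k) k \<and> orthonormal_cols W"
      "U = diag_block_mat Us"
    using orth_blockdiag_as_list[OF U] .
  obtain Vs where Vs: "length Vs = 2 ^ Suc L" "\<forall>W\<in>set Vs. W \<in> carrier_mat (2 * k) k \<and> orthonormal_cols W"
      "V = diag_block_mat Vs"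
    using orth_blockdiag_as_list[OF V] .
  obtain Ds where Ds: "length Ds = 2 ^ Suc L" "\<forall>W\<in>set Ds. W \<in> carrier_mat (2 * k) (2 * k)"
      "D = diag_block_mat Ds"
    using is_blockdiag_as_list[OF D] .
  obtain D0 U' V' D' where X': "factors_ok L k D0 U' V' D'" "X = telescope D0 U' V' D' L"
    using X by (auto simp: HSS_factors_ok)
  have "factors_ok (Suc L) k D0 (U'(Suc L := Us)) (V'(Suc L := Vs)) (D'(Suc L := Ds))"
    using X'(1) Us Vs Ds unfolding factors_ok_def by (auto simp: atLeastAtMostSuc_conv)
  moreover have "telescope D0 (U'(Suc L := Us)) (V'(Suc L := Vs)) (D'(Suc L := Ds)) (Suc L) = B"
    unfolding B X'(2) Us(3) Vs(3) Ds(3)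
    using telescope_cong[of L "U'(Suc L := Us)" U' "V'(Suc L := Vs)" V' "D'(Suc L := Ds)" D' D0] by simp
  ultimately show "B \<in> HSS (Suc L) k" unfolding HSS_factors_ok by blast
qed

lemma orth_blockdiag_carrier: "orth_blockdiag n k U \<Longrightarrow> U \<in> carrier_mat (n * (2 * k)) (n * k)"
  by (simp add: orth_blockdiag_def is_blockdiag_def)

lemma HSS_carrier: "B \<in> HSS L k \<Longrightarrow> B \<in> carrier_mat (2 ^ L * (2 * k)) (2 ^ L * (2 * k))"
  by (cases L) (auto simp: HSS_0 HSS_Suc dest!: orth_blockdiag_carrier is_blockdiag_carrier)

lemma mat_add_minus_assoc:
  fixes A B C :: "'a::ab_group_add mat"
  assumes "B \<in> carrier_mat m n" "C \<in> carrier_mat m n"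
  shows "A + B - C = A + (B - C)"
  using assms by (intro eq_matI) auto

lemma HSS_minus_blockdiag:
  assumes "B \<in> HSS L k" "is_blockdiag (2 ^ L) (2 * k) (2 * k) E"
  shows "B - E \<in> HSS L k"
proof (cases L)
  case 0
  then show ?thesis using assms by (auto simp: HSS_0 is_blockdiag_def intro: minus_carrier_mat)
next
  case (Suc L')
  obtain U V X D where UVXD: "orth_blockdiag (2 ^ L) k U" "orth_blockdiag (2 ^ L) k V"
     "X \<in> HSS L' k" "is_blockdiag (2 ^ L) (2 * k) (2 * k) D" "B = U * X * V\<^sup>T + D"
    using assms(1) unfolding Suc HSS_Suc by blast
  have "B - E = U * X * V\<^sup>T + (D - E)"
    unfolding UVXD(5) using is_blockdiag_carrier[OF UVXD(4)] is_blockdiag_carrier[OF assms(2)]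
    by (rule mat_add_minus_assoc)
  then show ?thesis
    using UVXD is_blockdiag_minus[OF UVXD(4) assms(2)] unfolding Suc HSS_Suc by blast
qed

text \<open>The blocks removed have size \<open>k\<close>, half the block size of this level. The
  diagonal part is block-diagonal also for size \<open>2 * k\<close>, so \<open>D\<close> absorbs
  it.\<close>

lemma HSS_off_diag:
  assumes "B \<in> HSS L k"
  shows "off_diag k B \<in> HSS L k"
proof -
  have "B \<in> carrier_mat (2 ^ L * 2 * k) (2 ^ L * 2 * k)"
    using HSS_carrier[OF assms] by (simp add: mult.assoc)
  then show ?thesis
    unfolding off_diag_def using assms
    by (intro HSS_minus_blockdiag is_blockdiag_coarsen is_blockdiag_diag_part)
qed

text \<open>\<open>P U\<close> need not have orthonormal columns; a blockwise factorization \<open>Q R\<close> restores them, and the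
  remaining factors are absorbed by the next level.\<close>

lemma HSS_conj:
  assumes "B \<in> HSS L k" "is_blockdiag (2 ^ Suc L) k k P" "is_blockdiag (2 ^ Suc L) k k Q"
  shows "P * B * Q\<^sup>T \<in> HSS L k"
  using assms
proof (induction L arbitrary: B P Q)
  case 0
  then show ?case by (auto simp: HSS_0 is_blockdiag_def)
next
  case (Suc L)
  let ?n = "2 ^ Suc L :: nat"
  obtain U V X D where UVXD: "orth_blockdiag ?n k U" "orth_blockdiag ?n k V"
     "X \<in> HSS L k" "is_blockdiag ?n (2 * k) (2 * k) D" "B = U * X * V\<^sup>T + D"
    using Suc.prems(1) unfolding HSS_Suc by blast
  have P: "is_blockdiag ?n (2 * k) (2 * k) P" and Q: "is_blockdiag ?n (2 * k) (2 * k) Q"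
  proof -
    have eq: "2 ^ Suc (Suc L) = ?n * 2" by simp
    show "is_blockdiag ?n (2 * k) (2 * k) P" "is_blockdiag ?n (2 * k) (2 * k) Q"
      using Suc.prems(2,3) unfolding eq by (simp_all only: is_blockdiag_coarsen)
  qed
  have "is_blockdiag ?n (2 * k) k (P * U)" "is_blockdiag ?n (2 * k) k (Q * V)"
    using UVXD P Q by (auto simp: orth_blockdiag_def intro: is_blockdiag_mult)
  then obtain U' R V' S where
      U': "orth_blockdiag ?n k U'" "is_blockdiag ?n k k R" "P * U = U' * R" and
      V': "orth_blockdiag ?n k V'" "is_blockdiag ?n k k S" "Q * V = V' * S"
    unfolding orth_blockdiag_def using is_blockdiag_qr[of ?n "2 * k" k] by (metis le_add2 mult_2)
  have "R * X * S\<^sup>T \<in> HSS L k"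
    using UVXD(3) U'(2) V'(2) by (rule Suc.IH)
  moreover have "is_blockdiag ?n (2 * k) (2 * k) (P * D * Q\<^sup>T)"
    using P Q UVXD(4) by (intro is_blockdiag_mult is_blockdiag_transpose)
  moreover have "P * B * Q\<^sup>T = U' * (R * X * S\<^sup>T) * V'\<^sup>T + P * D * Q\<^sup>T"
  proof -
    let ?N = "?n * (2 * k)" and ?M = "?n * k"
    have c: "P \<in> carrier_mat ?N ?N" "Q \<in> carrier_mat ?N ?N" "D \<in> carrier_mat ?N ?N"
        "U \<in> carrier_mat ?N ?M" "V \<in> carrier_mat ?N ?M" "U' \<in> carrier_mat ?N ?M" "V' \<in> carrier_mat ?N ?M"
        "R \<in> carrier_mat ?M ?M" "S \<in> carrier_mat ?M ?M"
      using P Q UVXD U' V' orth_blockdiag_carrier is_blockdiag_carrier by blast+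
    have X: "X \<in> carrier_mat ?M ?M"
      using HSS_carrier[OF UVXD(3)] by (simp add: mult_ac)
    have "P * B * Q\<^sup>T = (P * (U * X * V\<^sup>T) + P * D) * Q\<^sup>T"
      unfolding UVXD(5) using c X by (subst mult_add_distrib_mat[of _ ?N ?N _ ?N]) auto
    also have "\<dots> = P * (U * X * V\<^sup>T) * Q\<^sup>T + P * D * Q\<^sup>T"
      using c X by (intro add_mult_distrib_mat[of _ ?N ?N _ _ ?N]) auto
    also have "P * (U * X * V\<^sup>T) * Q\<^sup>T = (P * U) * X * (Q * V)\<^sup>T"
      using c X by (simp add: mat_transpose_mult mat_assoc)
    also have "\<dots> = U' * (R * X * S\<^sup>T) * V'\<^sup>T"
      unfolding U'(3) V'(3) using c X by (simp add: mat_transpose_mult mat_assoc)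
    finally show ?thesis .
  qed
  ultimately show ?case unfolding HSS_Suc using U' V' by blast
qed

text \<open>The \<open>k \<times> k\<close> diagonal blocks of \<open>X\<close> only contribute to the diagonal blocks of \<open>U X V\<^sup>T\<close>, so they
  can be moved into \<open>D\<close>. Then \<open>U X V\<^sup>T\<close> is the off-diagonal part of \<open>C\<close> itself, which determines \<open>X\<close>.\<close>

lemma HSS_Suc_off_diag:
  assumes "C \<in> HSS (Suc L) k"
  obtains U V Y where "orth_blockdiag (2 ^ Suc L) k U" "orth_blockdiag (2 ^ Suc L) k V" "Y \<in> HSS L k"
    "off_diag (2 * k) C = U * Y * V\<^sup>T"
proof -
  obtain U V X D where UVXD: "orth_blockdiag (2 ^ Suc L) k U" "orth_blockdiag (2 ^ Suc L) k V"
     "X \<in> HSS L k" "is_blockdiag (2 ^ Suc L) (2 * k) (2 * k) D" "C = U * X * V\<^sup>T + D"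
    using assms unfolding HSS_Suc by blast
  have "X \<in> carrier_mat (2 ^ Suc L * k) (2 ^ Suc L * k)"
    using HSS_carrier[OF UVXD(3)] by (simp add: mult_ac)
  then have "off_diag (2 * k) C = U * off_diag k X * V\<^sup>T"
    unfolding UVXD(5) using UVXD(1,2,4) by (intro off_diag_conj_add) (auto simp: orth_blockdiag_def)
  then show ?thesis using that UVXD HSS_off_diag by blast
qed

text \<open>With the off-diagonal part of \<open>C\<close> written as
  \<open>W * Y * Z\<^sup>T\<close>, compression yields
  \<open>(U\<^sup>T * W) * Y * (V\<^sup>T * Z)\<^sup>T\<close>. The outer factors are block-diagonal
  with k by k blocks but in general not orthonormal, the situation that \<open>HSS_conj\<close>
  covers.\<close>

lemma HSS_compress:
  assumes C: "C \<in> HSS (Suc L) k" and U: "is_blockdiag (2 ^ Suc L) (2 * k) k U" and V: "is_blockdiag (2 ^ Suc L) (2 * k) k V"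
  shows "U\<^sup>T * off_diag (2 * k) C * V \<in> HSS L k"
proof -
  let ?N = "2 ^ Suc L * (2 * k)" and ?M = "2 ^ Suc L * k"
  obtain W Z Y where W: "orth_blockdiag (2 ^ Suc L) k W" and Z: "orth_blockdiag (2 ^ Suc L) k Z" and Y: "Y \<in> HSS L k"
    and eq: "off_diag (2 * k) C = W * Y * Z\<^sup>T"
    using HSS_Suc_off_diag[OF C] .
  have c: "U \<in> carrier_mat ?N ?M" "V \<in> carrier_mat ?N ?M" "W \<in> carrier_mat ?N ?M" "Z \<in> carrier_mat ?N ?M"
    using U V W Z orth_blockdiag_carrier is_blockdiag_carrier by blast+
  have Yc: "Y \<in> carrier_mat ?M ?M"
    using HSS_carrier[OF Y] by (simp add: mult_ac)
  have "U\<^sup>T * off_diag (2 * k) C * V = (U\<^sup>T * W) * Y * (V\<^sup>T * Z)\<^sup>T"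
    unfolding eq using c Yc by (simp add: mat_transpose_mult mat_assoc)
  also have "\<dots> \<in> HSS L k"
    using U V W Z by (intro HSS_conj Y is_blockdiag_mult[of _ k "2 * k"] is_blockdiag_transpose)
      (auto simp: orth_blockdiag_def)
  finally show ?thesis .
qed

text \<open>The coarse matrix is an expression in \<open>C\<close>, \<open>U\<close> and
  \<open>V\<close>, so it converges whenever these do.\<close>

lemma off_diag_HSS_Suc:
  assumes "C \<in> HSS (Suc L) k"
  obtains U V where "orth_blockdiag (2 ^ Suc L) k U" "orth_blockdiag (2 ^ Suc L) k V"
    "U\<^sup>T * off_diag (2 * k) C * V \<in> HSS L k"
    "off_diag (2 * k) C = U * (U\<^sup>T * off_diag (2 * k) C * V) * V\<^sup>T"
proof -
  let ?N = "2 ^ Suc L * (2 * k)" and ?M = "2 ^ Suc L * k"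
  obtain U V Y where U: "orth_blockdiag (2 ^ Suc L) k U" and V: "orth_blockdiag (2 ^ Suc L) k V" and Y: "Y \<in> HSS L k"
    and eq: "off_diag (2 * k) C = U * Y * V\<^sup>T"
    using HSS_Suc_off_diag[OF assms] .
  have c: "U \<in> carrier_mat ?N ?M" "V \<in> carrier_mat ?N ?M"
    using U V orth_blockdiag_carrier by blast+
  have Yc: "Y \<in> carrier_mat ?M ?M"
    using HSS_carrier[OF Y] by (simp add: mult_ac)
  have "U\<^sup>T * (U * Y * V\<^sup>T) * V = (U\<^sup>T * U) * Y * (V\<^sup>T * V)"
    using c Yc by (simp add: mat_assoc)
  also have "\<dots> = Y"
    using U V c Yc by (simp add: orth_blockdiag_def orthonormal_cols_def)
  finally have "U\<^sup>T * off_diag (2 * k) C * V = Y" by (simp only: eq)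
  with U V Y eq show ?thesis using that[of U V] by simp
qed

lemma HSS_SucI:
  assumes C: "C \<in> carrier_mat (2 ^ Suc L * (2 * k)) (2 ^ Suc L * (2 * k))"
    and U: "orth_blockdiag (2 ^ Suc L) k U" and V: "orth_blockdiag (2 ^ Suc L) k V" and X: "X \<in> HSS L k"
    and eq: "off_diag (2 * k) C = U * X * V\<^sup>T"
  shows "C \<in> HSS (Suc L) k"
proof -
  have "C = off_diag (2 * k) C + diag_part (2 * k) C"
    unfolding off_diag_def by (rule eq_matI) auto
  then have "C = U * X * V\<^sup>T + diag_part (2 * k) C" by (simp only: eq)
  moreover have "is_blockdiag (2 ^ Suc L) (2 * k) (2 * k) (diag_part (2 * k) C)"
    using C by (rule is_blockdiag_diag_part)
  ultimately show ?thesis unfolding HSS_Suc using U V X by blast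
qed

section \<open>Closedness of the set of HSS matrices and best approximation\<close>

lemma mat_lim_off_diag:
  assumes "mat_lim m n X A"
  shows "mat_lim m n (\<lambda>j. off_diag p (X j)) (off_diag p A)"
proof -
  have "off_diag p (X j) $$ (a, b) = (if a div p = b div p then 0 else X j $$ (a, b))"
       "off_diag p A $$ (a, b) = (if a div p = b div p then 0 else A $$ (a, b))" if "a < m" "b < n" for a b j
    using mat_lim_carrier(1)[OF assms, of j] mat_lim_carrier(2)[OF assms] that by (auto simp: index_off_diag)
  then show ?thesis
    using assms by (auto simp: mat_lim_def off_diag_carrier)
qed

text \<open>For orthonormal columns \<open>fsq\<close> equals their number \<open>n * k\<close>, so
  a subsequence converges; the zero pattern and the equation for the Gram matrix survive in the
  limit.\<close>

lemma orth_blockdiag_subseq: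
  assumes "\<And>j. orth_blockdiag n k (U j)"
  shows "\<exists>r W. strict_mono (r :: nat \<Rightarrow> nat) \<and> mat_lim (n * (2 * k)) (n * k) (\<lambda>j. U (r j)) W \<and> orth_blockdiag n k W"
proof -
  have c: "U j \<in> carrier_mat (n * (2 * k)) (n * k)" for j
    using assms by (rule orth_blockdiag_carrier)
  have "fsq (U j) \<le> real (n * k)" for j
    using fsq_orthonormal_cols[of "U j"] assms[of j] c[of j] by (simp add: orth_blockdiag_def)
  then obtain r W where r: "strict_mono (r :: nat \<Rightarrow> nat)" "mat_lim (n * (2 * k)) (n * k) (\<lambda>j. U (r j)) W"
    using mat_bounded_subseq[of U "n * (2 * k)" "n * k" "real (n * k)", OF c] by blast
  have W: "W \<in> carrier_mat (n * (2 * k)) (n * k)" using r(2) by (rule mat_lim_carrier)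
  have "mat_lim (n * k) (n * k) (\<lambda>j. (U (r j))\<^sup>T * U (r j)) (W\<^sup>T * W)"
    by (rule mat_lim_mult[OF mat_lim_transpose[OF r(2)] r(2)])
  moreover have "(U (r j))\<^sup>T * U (r j) = 1\<^sub>m (n * k)" for j
    using assms[of "r j"] c[of "r j"] by (simp add: orth_blockdiag_def orthonormal_cols_def)
  ultimately have "W\<^sup>T * W = 1\<^sub>m (n * k)"
    using mat_lim_unique[OF _ mat_lim_const[of "1\<^sub>m (n * k)" "n * k" "n * k"]] by simp
  moreover have "W $$ (a, b) = 0" if "a < n * (2 * k)" "b < n * k" "a div (2 * k) \<noteq> b div k" for a b
  proof (rule LIMSEQ_unique)
    show "(\<lambda>j. U (r j) $$ (a, b)) \<longlonglongrightarrow> W $$ (a, b)" using r(2) that by (simp add: mat_lim_def)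
    show "(\<lambda>j. U (r j) $$ (a, b)) \<longlonglongrightarrow> 0"
      using assms that by (simp add: orth_blockdiag_def is_blockdiag_def)
  qed
  ultimately have "orth_blockdiag n k W"
    using W by (simp add: orth_blockdiag_def is_blockdiag_def orthonormal_cols_def)
  with r show ?thesis by blast
qed

text \<open>Factors \<open>U j\<close> and \<open>V j\<close> are chosen for each member, and both
  converge along a subsequence. The coarse matrices, as products of convergent matrices, converge
  too, and the induction hypothesis applies to their limit. The diagonal blocks are taken from
  \<open>A\<close> itself.\<close>

lemma HSS_closed:
  assumes "mat_lim (2 ^ L * (2 * k)) (2 ^ L * (2 * k)) X A" "\<And>j. X j \<in> HSS L k"
  shows "A \<in> HSS L k"
  using assms
proof (induction L arbitrary: X A)
  case 0
  then show ?case by (simp add: mat_lim_def HSS_0)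
next
  case (Suc L)
  let ?n = "2 ^ Suc L :: nat"
  let ?N = "?n * (2 * k)" and ?M = "?n * k"
  have "\<exists>U V. orth_blockdiag ?n k U \<and> orth_blockdiag ?n k V \<and>
      U\<^sup>T * off_diag (2 * k) (X j) * V \<in> HSS L k \<and>
      off_diag (2 * k) (X j) = U * (U\<^sup>T * off_diag (2 * k) (X j) * V) * V\<^sup>T" for j
    using off_diag_HSS_Suc[OF Suc.prems(2)[of j]] by metis
  then obtain U V where UV: "\<And>j. orth_blockdiag ?n k (U j)" "\<And>j. orth_blockdiag ?n k (V j)"
      "\<And>j. (U j)\<^sup>T * off_diag (2 * k) (X j) * V j \<in> HSS L k"
      "\<And>j. off_diag (2 * k) (X j) = U j * ((U j)\<^sup>T * off_diag (2 * k) (X j) * V j) * (V j)\<^sup>T"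
    by metis
  obtain r U' where r: "strict_mono (r :: nat \<Rightarrow> nat)" "mat_lim ?N ?M (\<lambda>j. U (r j)) U'" "orth_blockdiag ?n k U'"
    using orth_blockdiag_subseq[of ?n k U, OF UV(1)] by blast
  obtain q V' where q: "strict_mono (q :: nat \<Rightarrow> nat)" "mat_lim ?N ?M (\<lambda>j. V (r (q j))) V'" "orth_blockdiag ?n k V'"
    using orth_blockdiag_subseq[of ?n k "\<lambda>j. V (r j)", OF UV(2)] by blast
  have U': "mat_lim ?N ?M (\<lambda>j. U (r (q j))) U'" using mat_lim_subseq[OF r(2) q(1)] .
  have X': "mat_lim ?N ?N (\<lambda>j. off_diag (2 * k) (X (r (q j)))) (off_diag (2 * k) A)"
    using mat_lim_off_diag[OF mat_lim_subseq[OF mat_lim_subseq[OF Suc.prems(1) r(1)] q(1)]] .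
  have Y: "mat_lim ?M ?M (\<lambda>j. (U (r (q j)))\<^sup>T * off_diag (2 * k) (X (r (q j))) * V (r (q j)))
      (U'\<^sup>T * off_diag (2 * k) A * V')"
    by (rule mat_lim_mult[OF mat_lim_mult[OF mat_lim_transpose[OF U'] X'] q(2)])
  have dim: "?M = 2 ^ L * (2 * k)" by simp
  have "U'\<^sup>T * off_diag (2 * k) A * V' \<in> HSS L k"
    using Y UV(3) unfolding dim by (rule Suc.IH)
  moreover have "off_diag (2 * k) A = U' * (U'\<^sup>T * off_diag (2 * k) A * V') * V'\<^sup>T"
  proof (rule mat_lim_unique[OF X'])
    have "mat_lim ?N ?N (\<lambda>j. U (r (q j)) * ((U (r (q j)))\<^sup>T * off_diag (2 * k) (X (r (q j))) * V (r (q j))) * (V (r (q j)))\<^sup>T)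
      (U' * (U'\<^sup>T * off_diag (2 * k) A * V') * V'\<^sup>T)"
      by (rule mat_lim_mult[OF mat_lim_mult[OF U' Y] mat_lim_transpose[OF q(2)]])
    then show "mat_lim ?N ?N (\<lambda>j. off_diag (2 * k) (X (r (q j)))) (U' * (U'\<^sup>T * off_diag (2 * k) A * V') * V'\<^sup>T)"
      by (simp only: UV(4)[symmetric])
  qed
  ultimately show ?case
    using r(3) q(3) mat_lim_carrier(2)[OF Suc.prems(1)] by (intro HSS_SucI)
qed

text \<open>The HSS matrices no farther from \<open>A\<close> than a fixed \<open>C0\<close> form a
  bounded closed set, on which the error attains its minimum; all others are worse than
  \<open>C0\<close>.\<close>

lemma HSS_best_approximation:
  assumes A: "A \<in> carrier_mat (2 ^ L * (2 * k)) (2 ^ L * (2 * k))" and "HSS L k \<noteq> {}"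
  shows "\<exists>C\<in>HSS L k. \<forall>C'\<in>HSS L k. fsq (A - C) \<le> fsq (A - C')"
proof -
  let ?N = "2 ^ L * (2 * k)"
  obtain C0 where C0: "C0 \<in> HSS L k" using assms(2) by blast
  let ?S = "{C \<in> HSS L k. fsq (A - C) \<le> fsq (A - C0)}"
  have "\<exists>C\<in>?S. \<forall>C'\<in>?S. - fsq (A - C') \<le> - fsq (A - C)"
  proof (rule attains_max_of_subseq)
    show "?S \<noteq> {}" using C0 by blast
  next
    fix X :: "nat \<Rightarrow> real mat" assume X: "\<And>n. X n \<in> ?S"
    have Xc: "X n \<in> carrier_mat ?N ?N" for n using X HSS_carrier by blast
    have "A - X n \<in> carrier_mat ?N ?N" for n using Xc by (rule minus_carrier_mat)
    \<comment> \<open>The bound concerns \<open>A - X n\<close>, so these differences get the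
      convergent subsequence, and the limit of the \<open>X n\<close> is recovered as
      \<open>A - E\<close>.\<close>
    then obtain r E where r: "strict_mono (r :: nat \<Rightarrow> nat)" "mat_lim ?N ?N (\<lambda>n. A - X (r n)) E"
      using mat_bounded_subseq[of "\<lambda>n. A - X n" ?N ?N "fsq (A - C0)"] X by blast
    have "mat_lim ?N ?N (\<lambda>n. A - (A - X (r n))) (A - E)"
      by (intro mat_lim_minus mat_lim_const A r(2))
    moreover have "A - (A - X n) = X n" for n
      using A Xc[of n] by (intro eq_matI) auto
    ultimately have lim: "mat_lim ?N ?N (\<lambda>n. X (r n)) (A - E)" by simp
    then have "A - E \<in> HSS L k" by (rule HSS_closed) (use X in blast)
    moreover have "A - (A - E) = E"
      using A mat_lim_carrier(2)[OF r(2)] by (intro eq_matI) auto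
    moreover have "(\<lambda>n. fsq (A - X (r n))) \<longlonglongrightarrow> fsq E" using mat_lim_ip[OF r(2) r(2)] .
    moreover from this have "fsq E \<le> fsq (A - C0)"
      by (rule LIMSEQ_le_const2) (use X in blast)
    ultimately show "\<exists>r z. strict_mono (r :: nat \<Rightarrow> nat) \<and> z \<in> ?S \<and> (\<lambda>n. - fsq (A - X (r n))) \<longlonglongrightarrow> - fsq (A - z)"
      using r(1) by (intro exI[of _ r] exI[of _ "A - E"]) (auto intro: tendsto_minus)
  qed
  then obtain C where C: "C \<in> ?S" "\<forall>C'\<in>?S. fsq (A - C) \<le> fsq (A - C')" by auto
  moreover have "fsq (A - C) \<le> fsq (A - C')" if "C' \<in> HSS L k" for C'
    using C that by (cases "fsq (A - C') \<le> fsq (A - C0)") auto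
  ultimately show ?thesis by blast
qed

section \<open>One level of the greedy procedure\<close>

text \<open>The indices outside block \<open>i\<close> are enumerated in order by shifting those
  behind it by the block length \<open>p\<close>, which is how \<open>hss_block_row\<close> numbers
  its columns.\<close>

lemma sum_skip_block:
  fixes h :: "nat \<Rightarrow> 'a::comm_monoid_add"
  assumes i: "i < n" and zero: "\<And>b. i * p \<le> b \<Longrightarrow> b < i * p + p \<Longrightarrow> h b = 0"
  shows "(\<Sum>b<n * p. h b) = (\<Sum>b<(n - 1) * p. h (if b < i * p then b else b + p))"
proof -
  obtain m where n: "n = Suc m" using i by (cases n) auto
  define I where "I = i * p"
  define M where "M = m * p"
  have IM: "I \<le> M" using i n by (simp add: I_def M_def)
  have "(\<Sum>b<n * p. h b) = (\<Sum>b<M + p. h b)" by (simp add: n M_def add.commute)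
  also have "\<dots> = (\<Sum>b\<in>{..<M + p} - {I..<I + p}. h b)"
    using zero by (intro sum.mono_neutral_right) (auto simp: I_def)
  also have "\<dots> = (\<Sum>b<M. h (if b < I then b else b + p))"
    by (rule sum.reindex_bij_witness[of _ "\<lambda>b. if b < I then b else b + p" "\<lambda>b. if b < I then b else b - p"])
      (use IM in \<open>auto split: if_splits\<close>)
  finally show ?thesis by (simp add: n I_def M_def)
qed

text \<open>The diagonal blocks of the off-diagonal part are zero, so its block row \<open>i\<close>
  is \<open>hss_block_row\<close> with zero columns inserted. Maximizing over block-diagonal
  matrices hence splits into independent problems, one per block row.\<close>

lemma fsq_diag_block_off_diag:
  assumes A: "A \<in> carrier_mat (2 ^ l * (2 * k)) (2 ^ l * (2 * k))"
    and W: "\<And>i. i < 2 ^ l \<Longrightarrow> W i \<in> carrier_mat (2 * k) k"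
  shows "fsq ((blockdiag (2 ^ l) (2 * k) k W)\<^sup>T * off_diag (2 * k) A)
    = (\<Sum>i<2 ^ l. fsq ((W i)\<^sup>T * hss_block_row k l A i))"
proof -
  define n :: nat where "n = 2 ^ l"
  define p where "p = 2 * k"
  let ?F = "(blockdiag n p k W)\<^sup>T * off_diag p A"
  have A': "A \<in> carrier_mat (n * p) (n * p)" and W': "\<And>i. i < n \<Longrightarrow> W i \<in> carrier_mat p k"
    using A W by (simp_all add: n_def p_def)
  have F: "?F \<in> carrier_mat (n * k) (n * p)"
    by (rule carrier_matI) (use A' in auto)
  have entry: "?F $$ (i * k + c, b) = (\<Sum>a<p. W i $$ (a, c) * off_diag p A $$ (i * p + a, b))"
    if "i < n" "c < k" "b < n * p" for i c b
  proof -
    have "?F $$ (i * k + c, b) = (\<Sum>a<p. (W i)\<^sup>T $$ (c, a) * off_diag p A $$ (i * p + a, b))"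
      using index_blockdiag_mult[OF off_diag_carrier[OF A'] that, of "\<lambda>i. (W i)\<^sup>T"] blockdiag_transpose[of n W, OF W']
      by simp
    then show ?thesis using W'[OF that(1)] that by simp
  qed
  have "fsq ?F = (\<Sum>x<n * k. \<Sum>b<n * p. (?F $$ (x, b))\<^sup>2)"
    using ip_sum[OF F] by (simp add: power2_eq_square)
  also have "\<dots> = (\<Sum>i<n. \<Sum>c<k. \<Sum>b<n * p. (?F $$ (i * k + c, b))\<^sup>2)"
    by (rule sum_blocks)
  also have "\<dots> = (\<Sum>i<n. fsq ((W i)\<^sup>T * hss_block_row k l A i))"
  proof (rule sum.cong[OF refl])
    fix i assume "i \<in> {..<n}"
    then have i: "i < n" by simp
    let ?R = "hss_block_row k l A i"
    let ?\<phi> = "\<lambda>b. if b < i * p then b else b + p"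
    have R: "?R \<in> carrier_mat p ((n - 1) * p)" by (simp add: hss_block_row_def n_def p_def)
    have "(\<Sum>b<n * p. (?F $$ (i * k + c, b))\<^sup>2) = (\<Sum>b<(n - 1) * p. (((W i)\<^sup>T * ?R) $$ (c, b))\<^sup>2)"
      if c: "c < k" for c
    proof -
      \<comment> \<open>The squared entry in column \<open>b\<close>, set to zero on the deleted
        block: \<open>h\<close> mediates between the full row and the row without that
        block.\<close>
      define h where "h b = (if b div p = i then 0 else (\<Sum>a<p. W i $$ (a, c) * A $$ (i * p + a, b))\<^sup>2)" for b
      have "(\<Sum>b<n * p. (?F $$ (i * k + c, b))\<^sup>2) = (\<Sum>b<n * p. h b)"
      proof (rule sum.cong[OF refl])
        fix b assume "b \<in> {..<n * p}"
        then have b: "b < n * p" by simp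
        have "off_diag p A $$ (i * p + a, b) = (if b div p = i then 0 else A $$ (i * p + a, b))" if "a < p" for a
          using that b A' block_index_less[OF i that] by (auto simp: index_off_diag)
        then show "(?F $$ (i * k + c, b))\<^sup>2 = h b"
          unfolding entry[OF i c b] by (simp add: h_def)
      qed
      also have "\<dots> = (\<Sum>b<(n - 1) * p. h (?\<phi> b))"
      proof (rule sum_skip_block[OF i])
        fix b assume "i * p \<le> b" "b < i * p + p"
        then have "b div p = i" by (intro div_nat_eqI) (simp_all add: mult.commute)
        then show "h b = 0" by (simp add: h_def)
      qed
      also have "\<dots> = (\<Sum>b<(n - 1) * p. (((W i)\<^sup>T * ?R) $$ (c, b))\<^sup>2)"
      proof (rule sum.cong[OF refl])
        fix b assume b: "b \<in> {..<(n - 1) * p}"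
        then have p: "0 < p" by (cases p) auto
        \<comment> \<open>The shift jumps over block \<open>i\<close>: its image lies before or
          behind the block.\<close>
        have "?\<phi> b div p \<noteq> i"
        proof (cases "b < i * p")
          case True
          then show ?thesis using less_mult_imp_div_less[OF True] by simp
        next
          case False
          then have "i \<le> b div p" using p by (simp add: less_eq_div_iff_mult_less_eq)
          then show ?thesis using False p by simp
        qed
        then have "h (?\<phi> b) = (\<Sum>a<p. W i $$ (a, c) * A $$ (i * p + a, ?\<phi> b))\<^sup>2"
          by (simp add: h_def)
        also have "(\<Sum>a<p. W i $$ (a, c) * A $$ (i * p + a, ?\<phi> b)) = ((W i)\<^sup>T * ?R) $$ (c, b)"
          using index_mult_sum[of c "(W i)\<^sup>T" b ?R] W'[OF i] R b c
          by (simp add: hss_block_row_def n_def p_def)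
        finally show "h (?\<phi> b) = (((W i)\<^sup>T * ?R) $$ (c, b))\<^sup>2" .
      qed
      finally show ?thesis .
    qed
    then have "(\<Sum>c<k. \<Sum>b<n * p. (?F $$ (i * k + c, b))\<^sup>2)
        = (\<Sum>c<k. \<Sum>b<(n - 1) * p. (((W i)\<^sup>T * ?R) $$ (c, b))\<^sup>2)" by simp
    also have "\<dots> = fsq ((W i)\<^sup>T * ?R)"
      using ip_sum[of "(W i)\<^sup>T * ?R" k "(n - 1) * p"] W'[OF i] R by (simp add: power2_eq_square)
    finally show "(\<Sum>c<k. \<Sum>b<n * p. (?F $$ (i * k + c, b))\<^sup>2) = fsq ((W i)\<^sup>T * ?R)" .
  qed
  finally show ?thesis by (simp add: n_def p_def)
qed

text \<open>A relation, since the decomposition is not unique. Right singular vectors are handled as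
  left ones of the transpose.\<close>

definition top_left_vectors :: "nat \<Rightarrow> real mat \<Rightarrow> real mat \<Rightarrow> bool" where
  "top_left_vectors k M U \<longleftrightarrow> (\<exists>P S Q. is_svd M P S Q \<and> U = first_cols k P)"

lemma top_left_orthonormal:
  assumes "top_left_vectors k M U" "M \<in> carrier_mat m n" "k \<le> m" "k \<le> n"
  shows "U \<in> carrier_mat m k" "orthonormal_cols U"
proof -
  obtain P S Q where "is_svd M P S Q" "U = first_cols k P" using assms(1) by (auto simp: top_left_vectors_def)
  then show "U \<in> carrier_mat m k" "orthonormal_cols U"
    using assms(2-) orthonormal_first_cols[of P m "min m n" k] by (auto simp: is_svd_def Let_def)
qed

lemma hss_block_row_carrier: "hss_block_row k l A i \<in> carrier_mat (2 * k) ((2 ^ l - 1) * (2 * k))"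
  by (simp add: hss_block_row_def)

lemma hss_block_col_transpose:
  assumes A: "A \<in> carrier_mat (2 ^ l * (2 * k)) (2 ^ l * (2 * k))" and i: "i < 2 ^ l"
  shows "hss_block_col k l A i = (hss_block_row k l A\<^sup>T i)\<^sup>T"
proof (rule eq_matI)
  fix a b assume "a < dim_row (hss_block_row k l A\<^sup>T i)\<^sup>T" "b < dim_col (hss_block_row k l A\<^sup>T i)\<^sup>T"
  then have ab: "a < (2 ^ l - 1) * (2 * k)" "b < 2 * k" by (auto simp: hss_block_row_def)
  have "i * (2 * k) + b < 2 ^ l * (2 * k)" using i ab(2) by (rule block_index_less)
  \<comment> \<open>The shifted index has to stay inside \<open>A\<close> for an entry of its
    transpose to be rewritten; the deleted block leaves room for the shift.\<close>
  moreover have "a + 2 * k < 2 ^ l * (2 * k)"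
  proof -
    have "a + 2 * k < (2 ^ l - 1) * (2 * k) + 2 * k" using ab(1) by simp
    also have "\<dots> = Suc (2 ^ l - 1) * (2 * k)" by (simp only: mult_Suc add.commute)
    finally show ?thesis by simp
  qed
  ultimately show "hss_block_col k l A i $$ (a, b) = (hss_block_row k l A\<^sup>T i)\<^sup>T $$ (a, b)"
    using A ab by (simp add: hss_block_col_def hss_block_row_def)
qed (auto simp: hss_block_col_def hss_block_row_def)

text \<open>From level 1 on there is at least one other block, so a thin decomposition of a block
  row has at least \<open>k\<close> singular vectors and \<open>first_cols k\<close> selects actual
  columns.\<close>

lemma half_le_block_count: "k \<le> (2 ^ Suc l - 1) * (2 * k)" for k :: nat
proof -
  have "(1::nat) \<le> 2 ^ l" by simp
  then have "(1::nat) \<le> 2 ^ Suc l - 1" unfolding power_Suc by linarith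
  then have "1 * k \<le> (2 ^ Suc l - 1) * (2 * k)"
    by (rule mult_mono) auto
  then show ?thesis by simp
qed

text \<open>The objective is a sum over block rows, and Ky Fan's principle compares it term by
  term.\<close>

lemma top_left_rows_optimal:
  assumes A: "A \<in> carrier_mat (2 ^ Suc l * (2 * k)) (2 ^ Suc l * (2 * k))" and k: "1 \<le> k"
    and Us: "length Us = 2 ^ Suc l" "\<And>i. i < 2 ^ Suc l \<Longrightarrow> top_left_vectors k (hss_block_row k (Suc l) A i) (Us ! i)"
  shows "\<forall>U\<in>set Us. U \<in> carrier_mat (2 * k) k \<and> orthonormal_cols U"
    and "orth_blockdiag (2 ^ Suc l) k W \<Longrightarrow>
      fsq (W\<^sup>T * off_diag (2 * k) A) \<le> fsq ((diag_block_mat Us)\<^sup>T * off_diag (2 * k) A)"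
proof -
  let ?n = "2 ^ Suc l :: nat"
  have kn: "k \<le> (2 ^ Suc l - 1) * (2 * k)" by (rule half_le_block_count)
  have Ui: "Us ! i \<in> carrier_mat (2 * k) k" "orthonormal_cols (Us ! i)" if "i < ?n" for i
    using top_left_orthonormal[OF Us(2)[OF that] hss_block_row_carrier _ kn] by simp_all
  show U: "\<forall>U\<in>set Us. U \<in> carrier_mat (2 * k) k \<and> orthonormal_cols U"
    using Ui by (auto simp only: in_set_conv_nth Us(1))
  assume W: "orth_blockdiag ?n k W"
  obtain Ws where Ws: "\<And>i. Ws i \<in> carrier_mat (2 * k) k" "W = blockdiag ?n (2 * k) k Ws"
    using W by (auto simp: orth_blockdiag_def is_blockdiag_iff)
  have oWs: "orthonormal_cols (Ws i)" if "i < ?n" for i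
    using W Ws that by (simp add: orth_blockdiag_def orthonormal_cols_blockdiag del: power_Suc)
  have "fsq (W\<^sup>T * off_diag (2 * k) A) = (\<Sum>i<?n. fsq ((Ws i)\<^sup>T * hss_block_row k (Suc l) A i))"
    unfolding Ws(2) using A Ws(1) by (rule fsq_diag_block_off_diag)
  also have "\<dots> \<le> (\<Sum>i<?n. fsq ((Us ! i)\<^sup>T * hss_block_row k (Suc l) A i))"
  proof (rule sum_mono)
    fix i assume "i \<in> {..<?n}"
    then have i: "i < ?n" by simp
    obtain P S Q where svd: "is_svd (hss_block_row k (Suc l) A i) P S Q" "Us ! i = first_cols k P"
      using Us(2)[OF i] by (auto simp: top_left_vectors_def)
    show "fsq ((Ws i)\<^sup>T * hss_block_row k (Suc l) A i) \<le> fsq ((Us ! i)\<^sup>T * hss_block_row k (Suc l) A i)"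
      unfolding svd(2)
      by (rule ky_fan[OF svd(1) hss_block_row_carrier k _ kn Ws(1) oWs[OF i]]) simp
  qed
  also have "\<dots> = fsq ((blockdiag ?n (2 * k) k (\<lambda>i. Us ! i))\<^sup>T * off_diag (2 * k) A)"
    using A Ui(1) by (rule fsq_diag_block_off_diag[symmetric])
  also have "blockdiag ?n (2 * k) k (\<lambda>i. Us ! i) = diag_block_mat Us"
    using U Us(1) by (intro diag_block_mat_eq_blockdiag[symmetric]) auto
  finally show "fsq (W\<^sup>T * off_diag (2 * k) A) \<le> fsq ((diag_block_mat Us)\<^sup>T * off_diag (2 * k) A)" .
qed

text \<open>This is the row statement for \<open>A\<^sup>T\<close>, since block columns of
  \<open>A\<close> are transposed block rows of \<open>A\<^sup>T\<close> and \<open>fsq\<close> is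
  invariant under transposition.\<close>

lemma top_right_cols_optimal:
  assumes A: "A \<in> carrier_mat (2 ^ Suc l * (2 * k)) (2 ^ Suc l * (2 * k))" and k: "1 \<le> k"
    and Vs: "length Vs = 2 ^ Suc l" "\<And>i. i < 2 ^ Suc l \<Longrightarrow> top_left_vectors k (hss_block_col k (Suc l) A i)\<^sup>T (Vs ! i)"
  shows "\<forall>V\<in>set Vs. V \<in> carrier_mat (2 * k) k \<and> orthonormal_cols V"
    and "orth_blockdiag (2 ^ Suc l) k W \<Longrightarrow>
      fsq (off_diag (2 * k) A * W) \<le> fsq (off_diag (2 * k) A * diag_block_mat Vs)"
proof -
  have AT: "A\<^sup>T \<in> carrier_mat (2 ^ Suc l * (2 * k)) (2 ^ Suc l * (2 * k))" using A by simp
  have top: "top_left_vectors k (hss_block_row k (Suc l) A\<^sup>T i) (Vs ! i)" if "i < 2 ^ Suc l" for i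
    using Vs(2)[OF that] by (simp only: hss_block_col_transpose[OF A that] transpose_transpose)
  show V: "\<forall>V\<in>set Vs. V \<in> carrier_mat (2 * k) k \<and> orthonormal_cols V"
    using AT k Vs(1) top by (rule top_left_rows_optimal)
  assume W: "orth_blockdiag (2 ^ Suc l) k W"
  have flip: "fsq (X\<^sup>T * off_diag (2 * k) A\<^sup>T) = fsq (off_diag (2 * k) A * X)"
    if "X \<in> carrier_mat (2 ^ Suc l * (2 * k)) m" for X m
    using that A fsq_transpose[of "off_diag (2 * k) A * X"]
    by (simp add: mat_transpose_mult off_diag_transpose)
  have "fsq (W\<^sup>T * off_diag (2 * k) A\<^sup>T) \<le> fsq ((diag_block_mat Vs)\<^sup>T * off_diag (2 * k) A\<^sup>T)"
    using AT k Vs(1) top W by (rule top_left_rows_optimal(2))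
  moreover have "diag_block_mat Vs \<in> carrier_mat (2 ^ Suc l * (2 * k)) (2 ^ Suc l * k)"
    using V Vs(1) by (intro orth_blockdiag_carrier orth_blockdiag_diag_block_mat) auto
  ultimately show "fsq (off_diag (2 * k) A * W) \<le> fsq (off_diag (2 * k) A * diag_block_mat Vs)"
    using flip orth_blockdiag_carrier[OF W] by simp
qed

text \<open>The error of a level splits orthogonally into the part lost by compressing and the error of
  the compressed matrix. The former is at most a row error plus a column error, each bounded
  by the error of \<open>C\<close>, because the off-diagonal part of \<open>C\<close> factors through some \<open>W\<close> and \<open>Z\<close>.\<close>

lemma greedy_level_error:
  assumes A: "A \<in> carrier_mat (2 ^ Suc L * (2 * k)) (2 ^ Suc L * (2 * k))"
    and U: "orth_blockdiag (2 ^ Suc L) k U" and V: "orth_blockdiag (2 ^ Suc L) k V"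
    and E: "E = off_diag (2 * k) A"
    and optU: "\<And>W. orth_blockdiag (2 ^ Suc L) k W \<Longrightarrow> fsq (W\<^sup>T * E) \<le> fsq (U\<^sup>T * E)"
    and optV: "\<And>W. orth_blockdiag (2 ^ Suc L) k W \<Longrightarrow> fsq (E * W) \<le> fsq (E * V)"
    and C: "C \<in> HSS (Suc L) k" and B: "B \<in> carrier_mat (2 ^ Suc L * k) (2 ^ Suc L * k)"
    and best: "\<And>C'. C' \<in> HSS L k \<Longrightarrow> fsq (U\<^sup>T * E * V - B) \<le> \<gamma> * fsq (U\<^sup>T * E * V - C')" and \<gamma>: "0 \<le> \<gamma>"
  shows "fsq (A - (U * B * V\<^sup>T + diag_part (2 * k) A)) \<le> (2 + \<gamma>) * fsq (A - C)"
proof -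
  let ?N = "2 ^ Suc L * (2 * k)" and ?M = "2 ^ Suc L * k"
  let ?F = "off_diag (2 * k) C"
  have Ec: "E \<in> carrier_mat ?N ?N" unfolding E by (rule off_diag_carrier[OF A])
  have Cc: "C \<in> carrier_mat ?N ?N" using C by (rule HSS_carrier)
  have Fc: "?F \<in> carrier_mat ?N ?N" using Cc by (rule off_diag_carrier)
  have Uc: "U \<in> carrier_mat ?N ?M" and Vc: "V \<in> carrier_mat ?N ?M"
    using orth_blockdiag_carrier[OF U] orth_blockdiag_carrier[OF V] .
  have oU: "orthonormal_cols U" and oV: "orthonormal_cols V" using U V by (auto simp: orth_blockdiag_def)
  have EF: "fsq (E - ?F) \<le> fsq (A - C)"
    unfolding E off_diag_minus[OF A Cc, symmetric] by (rule fsq_off_diag_le)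
  obtain W Z Y where W: "orth_blockdiag (2 ^ Suc L) k W" and Z: "orth_blockdiag (2 ^ Suc L) k Z"
      and Y: "Y \<in> HSS L k" and F: "?F = W * Y * Z\<^sup>T"
    using HSS_Suc_off_diag[OF C] .
  have Wc: "W \<in> carrier_mat ?N ?M" and Zc: "Z \<in> carrier_mat ?N ?M"
    using orth_blockdiag_carrier[OF W] orth_blockdiag_carrier[OF Z] .
  have Yc: "Y \<in> carrier_mat ?M ?M"
    using HSS_carrier[OF Y] by (simp add: mult_ac)
  have rows: "fsq E - fsq (U\<^sup>T * E) \<le> fsq (A - C)"
  proof -
    have "fsq (E - W * (Y * Z\<^sup>T)) = fsq E - fsq (W\<^sup>T * E) + fsq (W\<^sup>T * E - Y * Z\<^sup>T)"
      using W Ec Wc Zc Yc by (intro fsq_split_left) (auto simp: orth_blockdiag_def)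
    moreover have "W * (Y * Z\<^sup>T) = ?F" unfolding F using Wc Yc Zc by (simp add: mat_assoc)
    ultimately show ?thesis using optU[OF W] EF fsq_nonneg[of "W\<^sup>T * E - Y * Z\<^sup>T"] by simp
  qed
  have cols: "fsq E - fsq (E * V) \<le> fsq (A - C)"
  proof -
    have "fsq (E\<^sup>T - Z * (W * Y)\<^sup>T) = fsq E\<^sup>T - fsq (Z\<^sup>T * E\<^sup>T) + fsq (Z\<^sup>T * E\<^sup>T - (W * Y)\<^sup>T)"
      using Z Ec Wc Zc Yc by (intro fsq_split_left) (auto simp: orth_blockdiag_def)
    moreover have "E\<^sup>T - Z * (W * Y)\<^sup>T = (E - ?F)\<^sup>T"
      unfolding F using Wc Yc Zc Ec by (simp add: transpose_minus[of _ ?N ?N] mat_transpose_mult mat_assoc)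
    moreover have "Z\<^sup>T * E\<^sup>T = (E * Z)\<^sup>T" using Zc Ec by (simp add: mat_transpose_mult)
    ultimately show ?thesis
      using optV[OF Z] EF fsq_nonneg[of "Z\<^sup>T * E\<^sup>T - (W * Y)\<^sup>T"] by (simp add: fsq_transpose)
  qed
  have "U\<^sup>T * ?F * V \<in> HSS L k"
    using C U V by (intro HSS_compress) (auto simp: orth_blockdiag_def)
  then have "fsq (U\<^sup>T * E * V - B) \<le> \<gamma> * fsq (U\<^sup>T * E * V - U\<^sup>T * ?F * V)" by (rule best)
  also have "U\<^sup>T * E * V - U\<^sup>T * ?F * V = U\<^sup>T * (E - ?F) * V"
    using Uc Vc Ec Cc by (simp add: mat_mult_minus mat_minus_mult del: assoc_mult_mat)
  also have "fsq (U\<^sup>T * (E - ?F) * V) \<le> fsq (U\<^sup>T * (E - ?F))"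
    using Vc Ec Fc oV by (intro fsq_mult_le) auto
  also have "\<dots> \<le> fsq (E - ?F)"
    using Uc Ec Fc oU by (intro fsq_transpose_mult_le) auto
  also note EF
  finally have rest: "fsq (U\<^sup>T * E * V - B) \<le> \<gamma> * fsq (A - C)"
    using \<gamma> by (simp add: mult_left_mono)
  \<comment> \<open>The diagonal blocks of \<open>A\<close> are copied into the result, so only
    \<open>E\<close> remains to be approximated.\<close>
  have "A - (U * B * V\<^sup>T + diag_part (2 * k) A) = E - U * B * V\<^sup>T"
    unfolding E off_diag_def using A Uc Vc B by (intro eq_matI) (auto simp del: index_mult_mat(1))
  then have "fsq (A - (U * B * V\<^sup>T + diag_part (2 * k) A))
      = fsq E - fsq (U\<^sup>T * E * V) + fsq (U\<^sup>T * E * V - B)"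
    using fsq_split[OF oU oV, of E B] Ec Uc Vc B by simp
  also have "\<dots> \<le> fsq (A - C) + fsq (A - C) + \<gamma> * fsq (A - C)"
    using fsq_two_sided[OF oU oV, of E] Ec Uc Vc rows cols rest by simp
  finally show ?thesis by (simp add: algebra_simps)
qed

section \<open>Runs and operation counts\<close>

lemma runs_return: "runs (return x) = {(x, 0)}"
  by (simp add: return_def)

lemma runs_bind: "runs (bind_comp m f) = {(y, s + t) | x s y t. (x, s) \<in> runs m \<and> (y, t) \<in> runs (f x)}"
  by (simp add: bind_comp_def)

lemma runs_bind_nonempty:
  assumes "runs m \<noteq> {}" "\<And>x s. (x, s) \<in> runs m \<Longrightarrow> runs (f x) \<noteq> {}"
  shows "runs (bind_comp m f) \<noteq> {}"
proof -
  obtain x s where "(x, s) \<in> runs m" using assms(1) by auto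
  moreover from this obtain y t where "(y, t) \<in> runs (f x)" using assms(2) by fastforce
  ultimately show ?thesis unfolding runs_bind by blast
qed

lemma runs_map_comp_nonempty:
  assumes "\<And>x. x \<in> set xs \<Longrightarrow> runs (f x) \<noteq> {}"
  shows "runs (map_comp f xs) \<noteq> {}"
  using assms
proof (induction xs)
  case Nil
  then show ?case by (simp add: runs_return)
next
  case (Cons x xs)
  then have "runs (f x) \<noteq> {}" "runs (map_comp f xs) \<noteq> {}" by simp_all
  then show ?case
    unfolding map_comp.simps by (intro runs_bind_nonempty) (simp_all add: runs_return)
qed

lemma runs_map_comp:
  assumes "(ys, t) \<in> runs (map_comp f xs)" "\<And>x y s. x \<in> set xs \<Longrightarrow> (y, s) \<in> runs (f x) \<Longrightarrow> R x y \<and> s \<le> c"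
  shows "list_all2 R xs ys \<and> t \<le> length xs * c"
  using assms
proof (induction xs arbitrary: ys t)
  case Nil
  then show ?case by (simp add: runs_return)
next
  case (Cons x xs)
  obtain y s ys' t' where y: "(y, s) \<in> runs (f x)" and ys': "(ys', t') \<in> runs (map_comp f xs)"
    and eq: "ys = y # ys'" "t = s + t'"
    using Cons.prems(1) by (auto simp: runs_bind runs_return)
  have "list_all2 R xs ys' \<and> t' \<le> length xs * c"
    by (rule Cons.IH[OF ys']) (use Cons.prems(2) in auto)
  moreover have "R x y \<and> s \<le> c" using Cons.prems(2)[OF _ y] by simp
  ultimately show ?case by (simp add: eq add_mono)
qed

lemma runs_left_comp:
  "runs (bind_comp (svd_comp sc M) (\<lambda>(P, S, Q). return (first_cols k P)))
    = {(U, sc (dim_row M) (dim_col M)) | U. top_left_vectors k M U}"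
  by (fastforce simp: runs_bind svd_comp_def runs_return top_left_vectors_def)

lemma top_left_transpose_iff: "top_left_vectors k M\<^sup>T V \<longleftrightarrow> (\<exists>P S Q. is_svd M P S Q \<and> V = first_cols k Q)"
  unfolding top_left_vectors_def using is_svd_transpose transpose_transpose by metis

lemma runs_right_comp:
  "runs (bind_comp (svd_comp sc M) (\<lambda>(P, S, Q). return (first_cols k Q)))
    = {(V, sc (dim_row M) (dim_col M)) | V. top_left_vectors k M\<^sup>T V}"
  by (fastforce simp: runs_bind svd_comp_def runs_return top_left_transpose_iff)

lemma runs_svd_comp_nonempty: "runs (svd_comp sc M) \<noteq> {}"
  using exists_svd by (auto simp: svd_comp_def)

text \<open>Every matrix has a singular value decomposition, so no choice gets stuck, whatever the
  dimensions of \<open>A\<close>.\<close>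

lemma runs_greedy_factors_nonempty: "runs (greedy_factors sc k l A) \<noteq> {}"
proof (induction l arbitrary: A)
  case 0
  then show ?case by (simp add: runs_return)
next
  case (Suc l)
  show ?case
    unfolding greedy_factors.simps Let_def
    by (intro runs_bind_nonempty runs_map_comp_nonempty)
      (auto simp: runs_svd_comp_nonempty minus_diag_def mult_diag_left_def mult_diag_right_def Suc runs_return
        split: prod.splits)
qed

lemma diag_block_mat_diag_block:
  assumes "A \<in> carrier_mat (n * (2 * k)) (n * (2 * k))"
  shows "diag_block_mat (map (diag_block k A) [0..<n]) = diag_part (2 * k) A"
proof -
  have "diag_block_mat (map (diag_block k A) [0..<n])
      = blockdiag n (2 * k) (2 * k) (\<lambda>i. map (diag_block k A) [0..<n] ! i)"
    by (intro diag_block_mat_eq_blockdiag) (auto simp: diag_block_def)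
  also have "\<dots> = diag_part (2 * k) A"
  proof (rule blockdiag_eqI[symmetric])
    show "diag_part (2 * k) A \<in> carrier_mat (n * (2 * k)) (n * (2 * k))"
      using assms by (rule diag_part_carrier)
    fix i a j b assume *: "i < n" "a < 2 * k" "j < n" "b < 2 * k"
    then have "i * (2 * k) + a < n * (2 * k)" "j * (2 * k) + b < n * (2 * k)"
      by (simp_all only: block_index_less)
    then show "diag_part (2 * k) A $$ (i * (2 * k) + a, j * (2 * k) + b)
        = (if i = j then (map (diag_block k A) [0..<n] ! i) $$ (a, b) else 0)"
      using * assms by (simp add: diag_part_def diag_block_def)
  qed
  finally show ?thesis .
qed

lemma diag_block_mat_map_transpose:
  assumes "\<forall>W\<in>set Ws. W \<in> carrier_mat p q"
  shows "diag_block_mat (map transpose_mat Ws) = (diag_block_mat Ws)\<^sup>T"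
proof -
  let ?n = "length Ws"
  have "diag_block_mat (map transpose_mat Ws) = blockdiag ?n q p (\<lambda>i. map transpose_mat Ws ! i)"
    using assms by (intro diag_block_mat_eq_blockdiag) auto
  also have "\<dots> = blockdiag ?n q p (\<lambda>i. (Ws ! i)\<^sup>T)" by (intro blockdiag_cong) simp
  also have "\<dots> = (blockdiag ?n p q (\<lambda>i. Ws ! i))\<^sup>T"
    using assms by (intro blockdiag_transpose[symmetric]) auto
  also have "blockdiag ?n p q (\<lambda>i. Ws ! i) = diag_block_mat Ws"
    using assms by (intro diag_block_mat_eq_blockdiag[symmetric]) auto
  finally show ?thesis .
qed

lemma sum_list_map_const:
  fixes f :: "'a \<Rightarrow> nat"
  assumes "\<And>x. x \<in> set xs \<Longrightarrow> f x = c"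
  shows "(\<Sum>x\<leftarrow>xs. f x) = length xs * c"
  using assms by (induction xs) auto

lemma mult_cost_le: "mult_cost m n p \<le> 2 * (m * n * p)"
proof -
  have "m * p * (n + (n - 1)) \<le> m * p * (2 * n)" by (intro mult_left_mono) auto
  then show ?thesis by (simp add: mult_cost_def mult_ac)
qed

text \<open>A level with \<open>n\<close> blocks decomposes \<open>n\<close> block rows with long
  side \<open>(n - 1) * (2 * k)\<close>, each at a price of at most \<open>c\<close> times
  \<open>k\<^sup>2\<close> times that side; the same count holds for the block columns.\<close>

lemma greedy_svd_cost_le: "n * (c * (k\<^sup>2 * ((n - 1) * (2 * k)))) \<le> 2 * c * (n\<^sup>2 * k ^ 3)" for n c k :: nat
proof -
  have "n * (c * (k\<^sup>2 * ((n - 1) * (2 * k)))) \<le> n * (c * (k\<^sup>2 * (n * (2 * k))))"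
    by (intro mult_left_mono mult_right_mono) auto
  also have "\<dots> = 2 * c * (n\<^sup>2 * k ^ 3)" by (simp add: power2_eq_square power3_eq_cube)
  finally show ?thesis .
qed

text \<open>Level \<open>l\<close> costs at most \<open>(4 c + 16) 4\<^sup>l k\<^sup>3\<close>, and the geometric sum of these is at most its
  last term times \<open>4\<close>.\<close>

lemma greedy_factors_correct:
  assumes k: "1 \<le> k" and sc: "\<And>n. 2 * k \<le> n \<Longrightarrow> sc (2 * k) n \<le> c * (k\<^sup>2 * n) \<and> sc n (2 * k) \<le> c * (k\<^sup>2 * n)"
    and "A \<in> carrier_mat (2 ^ L * (2 * k)) (2 ^ L * (2 * k))"
    and "((D0, U, V, D), t) \<in> runs (greedy_factors sc k L A)"
  shows "factors_ok L k D0 U V D \<and> t \<le> (4 * c + 16) * (4 ^ Suc L * k ^ 3) \<and>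
    (\<forall>C\<in>HSS L k. fsq (A - telescope D0 U V D L) \<le> 2 * real L * fsq (A - C))"
  using assms(3-)
proof (induction L arbitrary: A D0 U V D t)
  case 0
  \<comment> \<open>The result is \<open>A\<close> itself, so the error 0 meets the bound with
    constant 0.\<close>
  then show ?case by (auto simp: runs_return factors_ok_def HSS_0 ip_def)
next
  case (Suc L)
  let ?n = "2 ^ Suc L :: nat"
  let ?N = "?n * (2 * k)" and ?M = "?n * k"
  let ?Ds = "map (diag_block k A) [0..<?n]"
  note A = Suc.prems(1)
  obtain Us tu Vs tv U' V' D' t' where
      Us: "(Us, tu) \<in> runs (map_comp (\<lambda>i. bind_comp (svd_comp sc (hss_block_row k (Suc L) A i))
              (\<lambda>(P, S, Q). return (first_cols k P))) [0..<?n])" and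
      Vs: "(Vs, tv) \<in> runs (map_comp (\<lambda>i. bind_comp (svd_comp sc (hss_block_col k (Suc L) A i))
              (\<lambda>(P, S, Q). return (first_cols k Q))) [0..<?n])" and
      rec: "((D0, U', V', D'), t') \<in> runs (greedy_factors sc k L
              (diag_block_mat (map transpose_mat Us) * (A - diag_block_mat ?Ds) * diag_block_mat Vs))" and
      UVD: "U = U'(Suc L := Us)" "V = V'(Suc L := Vs)" "D = D'(Suc L := ?Ds)" and
      t: "t = tu + (tv + ((\<Sum>W\<leftarrow>?Ds. dim_row W * dim_col W)
          + ((\<Sum>W\<leftarrow>map transpose_mat Us. mult_cost (dim_row W) (dim_col W) (dim_col (A - diag_block_mat ?Ds)))
          + ((\<Sum>W\<leftarrow>Vs. mult_cost (dim_row (diag_block_mat (map transpose_mat Us) * (A - diag_block_mat ?Ds)))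
               (dim_row W) (dim_col W)) + t'))))"
    using Suc.prems(2)
    by (auto simp: runs_bind runs_return Let_def minus_diag_def mult_diag_left_def mult_diag_right_def simp del: power_Suc)
  \<comment> \<open>The cost hypothesis covers matrices whose long side is at least
    \<open>2 * k\<close>, which holds as there is at least one other block.\<close>
  have dims: "2 * k \<le> (?n - 1) * (2 * k)"
  proof -
    have "(1::nat) \<le> 2 ^ L" by simp
    then have "1 \<le> ?n - 1" unfolding power_Suc by linarith
    then have "1 * (2 * k) \<le> (?n - 1) * (2 * k)" by (rule mult_right_mono) simp
    then show ?thesis by simp
  qed
  let ?c = "c * (k\<^sup>2 * ((?n - 1) * (2 * k)))"
  have "list_all2 (\<lambda>i U. top_left_vectors k (hss_block_row k (Suc L) A i) U) [0..<?n] Us \<and> tu \<le> length [0..<?n] * ?c"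
    by (rule runs_map_comp[OF Us]) (use sc[OF dims] in \<open>auto simp: runs_left_comp hss_block_row_def simp del: power_Suc\<close>)
  then have Us_top: "length Us = ?n" "\<And>i. i < ?n \<Longrightarrow> top_left_vectors k (hss_block_row k (Suc L) A i) (Us ! i)"
      and tu: "tu \<le> ?n * ?c"
    by (auto simp: list_all2_conv_all_nth simp del: power_Suc)
  have "list_all2 (\<lambda>i V. top_left_vectors k (hss_block_col k (Suc L) A i)\<^sup>T V) [0..<?n] Vs \<and> tv \<le> length [0..<?n] * ?c"
    by (rule runs_map_comp[OF Vs]) (use sc[OF dims] in \<open>auto simp: runs_right_comp hss_block_col_def simp del: power_Suc\<close>)
  then have Vs_top: "length Vs = ?n" "\<And>i. i < ?n \<Longrightarrow> top_left_vectors k (hss_block_col k (Suc L) A i)\<^sup>T (Vs ! i)"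
      and tv: "tv \<le> ?n * ?c"
    by (auto simp: list_all2_conv_all_nth simp del: power_Suc)
  note Us_opt = top_left_rows_optimal[OF A k Us_top]
  note Vs_opt = top_right_cols_optimal[OF A k Vs_top]
  define UU where "UU = diag_block_mat Us"
  define VV where "VV = diag_block_mat Vs"
  define E where "E = off_diag (2 * k) A"
  have UU: "orth_blockdiag ?n k UU" and VV: "orth_blockdiag ?n k VV"
    using Us_opt(1) Vs_opt(1) Us_top(1) Vs_top(1) unfolding UU_def VV_def
    by (auto intro!: orth_blockdiag_diag_block_mat)
  have Ds: "diag_block_mat ?Ds = diag_part (2 * k) A" by (rule diag_block_mat_diag_block[OF A])
  have Et: "A - diag_block_mat ?Ds = E" unfolding Ds E_def off_diag_def ..
  have UT: "diag_block_mat (map transpose_mat Us) = UU\<^sup>T"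
    unfolding UU_def by (rule diag_block_mat_map_transpose) (use Us_opt(1) in blast)
  have Ec: "E \<in> carrier_mat ?N ?N" unfolding E_def by (rule off_diag_carrier[OF A])
  have UUc: "UU \<in> carrier_mat ?N ?M" and VVc: "VV \<in> carrier_mat ?N ?M"
    using orth_blockdiag_carrier[OF UU] orth_blockdiag_carrier[OF VV] .
  have "UU\<^sup>T * E * VV \<in> carrier_mat ?M ?M" using UUc VVc Ec by (intro carrier_matI) auto
  also have "?M = 2 ^ L * (2 * k)" by simp
  finally have A': "UU\<^sup>T * E * VV \<in> carrier_mat (2 ^ L * (2 * k)) (2 ^ L * (2 * k))" .
  have IH: "factors_ok L k D0 U' V' D'" "t' \<le> (4 * c + 16) * (4 ^ Suc L * k ^ 3)"
      "\<And>C. C \<in> HSS L k \<Longrightarrow> fsq (UU\<^sup>T * E * VV - telescope D0 U' V' D' L) \<le> 2 * real L * fsq (UU\<^sup>T * E * VV - C)"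
    using Suc.IH[OF A'] rec unfolding UT Et VV_def[symmetric] by auto
  have ok: "factors_ok (Suc L) k D0 U V D"
    using IH(1) Us_opt(1) Vs_opt(1) Us_top(1) Vs_top(1) unfolding factors_ok_def UVD
    by (auto simp: atLeastAtMostSuc_conv diag_block_def)
  have tel: "telescope D0 U V D (Suc L) = UU * telescope D0 U' V' D' L * VV\<^sup>T + diag_part (2 * k) A"
    using telescope_cong[of L U U' V V' D D' D0] by (simp add: UVD UU_def VV_def flip: Ds)
  have Bc: "telescope D0 U' V' D' L \<in> carrier_mat ?M ?M"
  proof -
    have "telescope D0 U' V' D' L \<in> HSS L k" using IH(1) by (auto simp: HSS_factors_ok)
    from HSS_carrier[OF this] show ?thesis by (simp add: mult_ac)
  qed
  have err: "fsq (A - telescope D0 U V D (Suc L)) \<le> 2 * real (Suc L) * fsq (A - C)" if C: "C \<in> HSS (Suc L) k" for C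
  proof -
    have "fsq (A - telescope D0 U V D (Suc L)) \<le> (2 + 2 * real L) * fsq (A - C)"
      unfolding tel
      by (rule greedy_level_error[OF A UU VV E_def _ _ C Bc IH(3)])
        (use Us_opt(2) Vs_opt(2) in \<open>simp_all add: UU_def VV_def E_def\<close>)
    then show ?thesis by (simp add: algebra_simps)
  qed
  have "t \<le> (4 * c + 16) * (4 ^ Suc (Suc L) * k ^ 3)"
  proof -
    let ?x = "?n\<^sup>2 * k ^ 3"
    have t1: "(\<Sum>W\<leftarrow>?Ds. dim_row W * dim_col W) = ?n * ((2 * k) * (2 * k))"
      by (subst sum_list_map_const[where c = "(2 * k) * (2 * k)"]) (auto simp: diag_block_def)
    have t2: "(\<Sum>W\<leftarrow>map transpose_mat Us. mult_cost (dim_row W) (dim_col W) (dim_col E)) = ?n * mult_cost k (2 * k) ?N"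
      using Us_opt(1) Us_top(1) Ec by (subst sum_list_map_const[where c = "mult_cost k (2 * k) ?N"]) auto
    have t3: "(\<Sum>W\<leftarrow>Vs. mult_cost (dim_row (UU\<^sup>T * E)) (dim_row W) (dim_col W)) = ?n * mult_cost ?M (2 * k) k"
      using Vs_opt(1) Vs_top(1) UUc by (subst sum_list_map_const[where c = "mult_cost ?M (2 * k) k"]) auto
    have "?n * ((2 * k) * (2 * k)) \<le> 4 * ?x"
    proof -
      have "?n * k\<^sup>2 \<le> ?n\<^sup>2 * k ^ 3"
        using k by (intro mult_mono power_increasing) (auto simp: power2_eq_square)
      then show ?thesis by (simp add: power2_eq_square)
    qed
    moreover have "?n * mult_cost k (2 * k) ?N \<le> 8 * ?x"
    proof -
      have "?n * mult_cost k (2 * k) ?N \<le> ?n * (2 * (k * (2 * k) * ?N))"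
        by (intro mult_left_mono mult_cost_le) simp
      also have "\<dots> = 8 * ?x" by (simp add: power2_eq_square power3_eq_cube)
      finally show ?thesis .
    qed
    moreover have "?n * mult_cost ?M (2 * k) k \<le> 4 * ?x"
    proof -
      have "?n * mult_cost ?M (2 * k) k \<le> ?n * (2 * (?M * (2 * k) * k))"
        by (intro mult_left_mono mult_cost_le) simp
      also have "\<dots> = 4 * ?x" by (simp add: power2_eq_square power3_eq_cube)
      finally show ?thesis .
    qed
    moreover have "?n * ?c \<le> 2 * c * ?x" by (rule greedy_svd_cost_le)
    \<comment> \<open>Block rows and block columns contribute 2 c each; subtraction, left product
      and right product contribute 4, 8 and 4, together 16.\<close>
    ultimately have "t \<le> 2 * c * ?x + (2 * c * ?x + (4 * ?x + (8 * ?x + (4 * ?x + t'))))"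
      unfolding t UT Et t1 t2 t3 using tu tv by linarith
    also have "\<dots> = (4 * c + 16) * ?x + t'" by (simp add: algebra_simps)
    also have "?x = 4 ^ Suc L * k ^ 3"
      by (simp add: power_mult_distrib[symmetric] power2_eq_square flip: power_mult)
    also have "(4 * c + 16) * (4 ^ Suc L * k ^ 3) + t' \<le> 2 * ((4 * c + 16) * (4 ^ Suc L * k ^ 3))"
      using IH(2) by linarith
    also have "\<dots> \<le> 4 * ((4 * c + 16) * (4 ^ Suc L * k ^ 3))" by simp
    finally show ?thesis by (simp add: mult_ac)
  qed
  with ok err show ?case by blast
qed

text \<open>Multiplying out involves no choice, so there is exactly one run. Left product, right
  product and addition at level \<open>l\<close> cost at most 4 + 8 + 4 = 16 times
  \<open>4 ^ l * k ^ 3\<close>. The coarser levels together stay within the same amount, while the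
  bound grows by a factor of 4 per level.\<close>

lemma runs_telescope_comp:
  assumes "1 \<le> k" "factors_ok L k D0 U V D"
  shows "\<exists>t \<le> 16 * (4 ^ Suc L * k ^ 3). runs (telescope_comp D0 U V D L) = {(telescope D0 U V D L, t)}"
  using assms(2)
proof (induction L)
  case 0
  then show ?case by (simp add: runs_return)
next
  case (Suc L)
  let ?n = "2 ^ Suc L :: nat"
  let ?N = "?n * (2 * k)" and ?M = "?n * k"
  let ?B = "telescope D0 U V D L"
  let ?U = "U (Suc L)" and ?V = "V (Suc L)" and ?D = "D (Suc L)"
  have ok: "factors_ok L k D0 U V D" using Suc.prems unfolding factors_ok_def by auto
  then obtain t' where t': "t' \<le> 16 * (4 ^ Suc L * k ^ 3)" "runs (telescope_comp D0 U V D L) = {(?B, t')}"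
    using Suc.IH by blast
  have lens: "length ?U = ?n" "length ?V = ?n" "length ?D = ?n"
    and U: "\<forall>W\<in>set ?U. W \<in> carrier_mat (2 * k) k" and V: "\<forall>W\<in>set ?V. W \<in> carrier_mat (2 * k) k"
    and D: "\<forall>W\<in>set ?D. W \<in> carrier_mat (2 * k) (2 * k)"
    using Suc.prems by (auto simp: factors_ok_def simp del: power_Suc)
  have Bc: "?B \<in> carrier_mat ?M ?M"
  proof -
    have "?B \<in> HSS L k" using ok by (auto simp: HSS_factors_ok)
    from HSS_carrier[OF this] show ?thesis by (simp add: mult_ac)
  qed
  have Uc: "diag_block_mat ?U \<in> carrier_mat ?N ?M"
    using U lens by (intro is_blockdiag_carrier is_blockdiag_diag_block_mat) auto
  define t where "t = t' + ((\<Sum>W\<leftarrow>?U. mult_cost (dim_row W) (dim_col W) (dim_col ?B))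
    + ((\<Sum>W\<leftarrow>map transpose_mat ?V. mult_cost (dim_row (diag_block_mat ?U * ?B)) (dim_row W) (dim_col W))
    + (\<Sum>W\<leftarrow>?D. dim_row W * dim_col W)))"
  have "runs (telescope_comp D0 U V D (Suc L)) = {(telescope D0 U V D (Suc L), t)}"
    using diag_block_mat_map_transpose[OF V]
    by (simp add: runs_bind t'(2) mult_diag_left_def mult_diag_right_def add_diag_def t_def)
  moreover have "t \<le> 16 * (4 ^ Suc (Suc L) * k ^ 3)"
  proof -
    let ?x = "?n\<^sup>2 * k ^ 3"
    have t1: "(\<Sum>W\<leftarrow>?U. mult_cost (dim_row W) (dim_col W) (dim_col ?B)) = ?n * mult_cost (2 * k) k ?M"
      using U lens Bc by (subst sum_list_map_const[where c = "mult_cost (2 * k) k ?M"]) auto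
    have t2: "(\<Sum>W\<leftarrow>map transpose_mat ?V. mult_cost (dim_row (diag_block_mat ?U * ?B)) (dim_row W) (dim_col W))
        = ?n * mult_cost ?N k (2 * k)"
      using V lens Uc by (subst sum_list_map_const[where c = "mult_cost ?N k (2 * k)"]) auto
    have t3: "(\<Sum>W\<leftarrow>?D. dim_row W * dim_col W) = ?n * ((2 * k) * (2 * k))"
      using D lens by (subst sum_list_map_const[where c = "(2 * k) * (2 * k)"]) auto
    have "?n * ((2 * k) * (2 * k)) \<le> 4 * ?x"
    proof -
      have "?n * k\<^sup>2 \<le> ?n\<^sup>2 * k ^ 3"
        using assms(1) by (intro mult_mono power_increasing) (auto simp: power2_eq_square)
      then show ?thesis by (simp add: power2_eq_square)
    qed
    moreover have "?n * mult_cost (2 * k) k ?M \<le> 4 * ?x"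
    proof -
      have "?n * mult_cost (2 * k) k ?M \<le> ?n * (2 * (2 * k * k * ?M))"
        by (intro mult_left_mono mult_cost_le) simp
      also have "\<dots> = 4 * ?x" by (simp add: power2_eq_square power3_eq_cube)
      finally show ?thesis .
    qed
    moreover have "?n * mult_cost ?N k (2 * k) \<le> 8 * ?x"
    proof -
      have "?n * mult_cost ?N k (2 * k) \<le> ?n * (2 * (?N * k * (2 * k)))"
        by (intro mult_left_mono mult_cost_le) simp
      also have "\<dots> = 8 * ?x" by (simp add: power2_eq_square power3_eq_cube)
      finally show ?thesis .
    qed
    ultimately have "t \<le> t' + (4 * ?x + (8 * ?x + 4 * ?x))"
      unfolding t_def t1 t2 t3 by linarith
    also have "\<dots> = t' + 16 * ?x" by simp
    also have "?x = 4 ^ Suc L * k ^ 3"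
      by (simp add: power_mult_distrib[symmetric] power2_eq_square flip: power_mult)
    also have "t' + 16 * (4 ^ Suc L * k ^ 3) \<le> 2 * (16 * (4 ^ Suc L * k ^ 3))"
      using t'(1) by linarith
    also have "\<dots> \<le> 4 * (16 * (4 ^ Suc L * k ^ 3))" by simp
    finally show ?thesis by (simp add: mult_ac)
  qed
  ultimately show ?case by blast
qed

text \<open>\<open>K\<close> depends only on the constant of the cost hypothesis, and the minimizer
  is chosen before the run, so it serves every choice of singular vectors.\<close>

theorem mainTheorem2:
  fixes svd_cost :: "nat \<Rightarrow> nat \<Rightarrow> nat"
  assumes svd_cost: "\<exists>c. \<forall>k\<ge>1. \<forall>n\<ge>2 * k.
      svd_cost (2 * k) n \<le> c * (k\<^sup>2 * n) \<and> svd_cost n (2 * k) \<le> c * (k\<^sup>2 * n)"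
  shows "\<exists>K::nat. \<forall>k\<ge>1. \<forall>L\<ge>1. \<forall>N. N = 2 ^ (L + 1) * k \<longrightarrow>
    (\<forall>A\<in>carrier_mat N N.
       runs (greedy_hss svd_cost k L A) \<noteq> {} \<and>
       (\<exists>C\<^sub>0. is_arg_min (\<lambda>C. (frob_norm (A - C))\<^sup>2) (\<lambda>C. C \<in> HSS L k) C\<^sub>0 \<and>
          (\<forall>(B, t)\<in>runs (greedy_hss svd_cost k L A).
             t \<le> K * (N\<^sup>2 * k) \<and>
             B \<in> HSS L k \<and>
             (frob_norm (A - B))\<^sup>2 \<le> 2 * real L * (frob_norm (A - C\<^sub>0))\<^sup>2)))"
proof -
  obtain c where c: "\<And>k n. 1 \<le> k \<Longrightarrow> 2 * k \<le> n \<Longrightarrow>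
      svd_cost (2 * k) n \<le> c * (k\<^sup>2 * n) \<and> svd_cost n (2 * k) \<le> c * (k\<^sup>2 * n)"
    using svd_cost by blast
  \<comment> \<open>The constant is \<open>4 * c + 16\<close> for the factors plus 16 for
    multiplying them out.\<close>
  have "runs (greedy_hss svd_cost k L A) \<noteq> {} \<and>
       (\<exists>C\<^sub>0. is_arg_min (\<lambda>C. (frob_norm (A - C))\<^sup>2) (\<lambda>C. C \<in> HSS L k) C\<^sub>0 \<and>
          (\<forall>(B, t)\<in>runs (greedy_hss svd_cost k L A).
             t \<le> (4 * c + 32) * (N\<^sup>2 * k) \<and>
             B \<in> HSS L k \<and>
             (frob_norm (A - B))\<^sup>2 \<le> 2 * real L * (frob_norm (A - C\<^sub>0))\<^sup>2))"
    if k: "1 \<le> k" and N: "N = 2 ^ (L + 1) * k" and AN: "A \<in> carrier_mat N N" for k L N A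
  proof -
    have A: "A \<in> carrier_mat (2 ^ L * (2 * k)) (2 ^ L * (2 * k))" using AN by (simp add: N mult_ac)
    have size: "N\<^sup>2 * k = 4 ^ Suc L * k ^ 3"
    proof -
      have "N\<^sup>2 = (2 ^ 2) ^ Suc L * k\<^sup>2"
        unfolding N by (simp only: power_mult_distrib power_mult[symmetric] mult.commute Suc_eq_plus1)
      then show ?thesis by (simp add: power2_eq_square power3_eq_cube)
    qed
    have run: "t \<le> (4 * c + 32) * (N\<^sup>2 * k) \<and> B \<in> HSS L k \<and>
        (\<forall>C\<in>HSS L k. fsq (A - B) \<le> 2 * real L * fsq (A - C))"
      if Bt: "(B, t) \<in> runs (greedy_hss svd_cost k L A)" for B t
    proof -
      obtain D0 U V D s s' where s: "((D0, U, V, D), s) \<in> runs (greedy_factors svd_cost k L A)"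
          and s': "(B, s') \<in> runs (telescope_comp D0 U V D L)" and t: "t = s + s'"
        using Bt by (auto simp: greedy_hss_def runs_bind)
      note greedy = greedy_factors_correct[OF k c[OF k] A s]
      then have "B = telescope D0 U V D L" "s' \<le> 16 * (4 ^ Suc L * k ^ 3)"
        using runs_telescope_comp[OF k, of L D0 U V D] s' by auto
      moreover from this greedy have "B \<in> HSS L k" by (auto simp: HSS_factors_ok)
      moreover have "t \<le> (4 * c + 32) * (N\<^sup>2 * k)"
        using greedy calculation(2) unfolding t size by (simp add: algebra_simps)
      ultimately show ?thesis using greedy by blast
    qed
    have nonempty: "runs (greedy_hss svd_cost k L A) \<noteq> {}"
      unfolding greedy_hss_def
    proof (rule runs_bind_nonempty[OF runs_greedy_factors_nonempty])
      fix x s assume x: "(x, s) \<in> runs (greedy_factors svd_cost k L A)"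
      obtain D0 U V D where eq: "x = (D0, U, V, D)" by (cases x)
      show "runs (case x of (D0, U, V, D) \<Rightarrow> telescope_comp D0 U V D L) \<noteq> {}"
        using greedy_factors_correct[OF k c[OF k] A x[unfolded eq]] runs_telescope_comp[OF k, of L D0 U V D]
        by (auto simp: eq)
    qed
    \<comment> \<open>The output of any run is a witness, which makes the existence of a best
      approximation applicable.\<close>
    then have "HSS L k \<noteq> {}" using run by fastforce
    then obtain C where "C \<in> HSS L k" "\<forall>C'\<in>HSS L k. fsq (A - C) \<le> fsq (A - C')"
      using HSS_best_approximation[OF A] by blast
    then have "is_arg_min (\<lambda>C. (frob_norm (A - C))\<^sup>2) (\<lambda>C. C \<in> HSS L k) C" "C \<in> HSS L k"
      by (auto simp: is_arg_min_def frob_norm_sq not_less)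
    with nonempty run show ?thesis by (auto simp: frob_norm_sq)
  qed
  then show ?thesis by blast
qed

end
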